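(* Let $E_0$ be a real-analytic vector field on $\mathbb{S}^3$ that is Legendrian with respect to the standard contact structure, and let $B_0:=JE_0$. Then $(E_0,B_0)$ yields an electromagnetic Bateman solution of Hopf type, i.e. there is a Bateman field of Hopf type $F=h(\alpha,\beta)\,\nabla\alpha\times\nabla\beta$ on $\mathbb{R}^3\times\mathbb{R}$ whose corresponding pair of Legendrian fields on $\mathbb{S}^3$ is $(E_0,B_0)$, if and only if both $E_0$ and $B_0$ are divergence-free on $\mathbb{S}^3$.
   Context: $\mathbb{S}^3=\{(z_1,z_2)\in\mathbb{C}^2:|z_1|^2+|z_2|^2=1\}$ with $z_j=x_j+\mathrm{i}y_j$, endowed with its canonical round metric and standard volume form (divergence is taken with respect to it). The standard contact structure is the kernel on $T\mathbb{S}^3$ of the $1$-form $-y_1dx_1+x_1dy_1-y_2dx_2+x_2dy_2$; a vector field on $\mathbb{S}^3$ is Legendrian if it is everywhere tangent to this kernel. $J$ denotes the complex structure of $\mathbb{C}^2$ ($J\partial_{x_j}=\partial_{y_j}$, $J\partial_{y_j}=-\partial_{x_j}$); it maps Legendrian fields to Legendrian fields. The contact planes are spanned at every point by $v_1=-x_2\partial_{x_1}+y_2\partial_{y_1}+x_1\partial_{x_2}-y_1\partial_{y_2}$ and $v_2=-y_2\partial_{x_1}-x_2\partial_{y_1}+y_1\partial_{x_2}+x_1\partial_{y_2}$. A Bateman field of Hopf type is a map $F=E+\mathrm{i}B:\mathbb{R}^3\times\mathbb{R}\to\mathbb{C}^3$ of the form $F=h(\alpha,\beta)\,\nabla\alpha\times\nabla\beta$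 ($\nabla$ is the spatial gradient), where $$\alpha=\frac{x^2+y^2+z^2-t^2-1+2\mathrm{i}z}{x^2+y^2+z^2-(t-\mathrm{i})^2},\qquad \beta=\frac{2(x-\mathrm{i}y)}{x^2+y^2+z^2-(t-\mathrm{i})^2},$$ (so that $|\alpha|^2+|\beta|^2=1$) and $h$ is a holomorphic function on some neighbourhood of $\mathbb{S}^3$ in $\mathbb{C}^2$. Its real and imaginary parts $E,B$ solve Maxwell's equations in free space with $E\cdot B=0$, $|E|=|B|$ for all time. The pair of Legendrian fields on $\mathbb{S}^3$ corresponding to $F$ is $(\mathrm{Re}\,\widetilde F,\mathrm{Im}\,\widetilde F)$, where $\widetilde F:=h(z_1,z_2)(v_1+\mathrm{i}v_2)$ on $\mathbb{S}^3$; for each $t$ it equals, up to a real factor, the pushforward of $(E,B)|_t$ by $(\alpha,\beta)|_t$. *)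

theory Defs
  imports "HOL-Analysis.Analysis"
begin

section \<open>Real-analytic maps\<close>

text \<open>
  A power series in the coordinates with respect to the standard basis. The multi-indices are the
  functions on \<open>Basis\<close>; unconditional summability is absolute summability in finite dimension.
\<close>

definition real_analytic_at :: "('a::euclidean_space \<Rightarrow> 'b::euclidean_space) \<Rightarrow> 'a \<Rightarrow> bool" where
  "real_analytic_at f p \<longleftrightarrow>
     (\<exists>c r. 0 < r \<and>
       (\<forall>x\<in>ball p r.
          ((\<lambda>m. (\<Prod>b\<in>Basis. ((x - p) \<bullet> b) ^ m b) *\<^sub>R c m) has_sum f x)
            (Basis \<rightarrow>\<^sub>E (UNIV :: nat set))))"

text \<open>
  Analyticity of a map defined on an embedded analytic submanifold \<open>S\<close>: local existence of analytic
  extensions to the ambient space. For a vector field this is applied to its ambient components.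
\<close>

definition real_analytic_on_submanifold ::
    "('a::euclidean_space \<Rightarrow> 'b::euclidean_space) \<Rightarrow> 'a set \<Rightarrow> bool" where
  "real_analytic_on_submanifold f S \<longleftrightarrow>
     (\<forall>p\<in>S. \<exists>U g. open U \<and> p \<in> U \<and> (\<forall>q\<in>U. real_analytic_at g q) \<and> (\<forall>q\<in>U \<inter> S. g q = f q))"


section \<open>The round three-sphere\<close>

text \<open>
  The point \<open>(z1, z2)\<close> has \<open>zj = xj + i yj\<close>, and the tangent vector
  \<open>a1 \<partial>x1 + b1 \<partial>y1 + a2 \<partial>x2 + b2 \<partial>y2\<close> is written \<open>(a1 + i b1, a2 + i b2)\<close>. The inner product \<open>\<bullet>\<close> on
  \<open>complex \<times> complex\<close> is the Euclidean one of the underlying real four-space. Vector fields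
  on the sphere are total functions of which only the values on the sphere matter.
\<close>

definition S3 :: "(complex \<times> complex) set" where
  "S3 = {(z1, z2). (cmod z1)\<^sup>2 + (cmod z2)\<^sup>2 = 1}"

definition tangent_S3 :: "complex \<times> complex \<Rightarrow> (complex \<times> complex) set" where
  "tangent_S3 p = {w. w \<bullet> p = 0}"

text \<open>
  The Riemannian divergence (equivalently, the divergence for the Riemannian volume form) is the
  trace of \<open>w \<mapsto> \<nabla>\<^sub>w X\<close> on the tangent space. The Levi-Civita derivative \<open>\<nabla>\<^sub>w X\<close> of the round metric is
  the tangential projection of the ambient derivative \<open>D w\<close>, so that \<open>\<nabla>\<^sub>e X \<bullet> e = D e \<bullet> e\<close> for
  tangent \<open>e\<close>. A derivative within the sphere is determined by \<open>X\<close> on tangent vectors, and these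
  are the only ones to which \<open>D\<close> is applied.
\<close>

definition orthonormal_basis_of :: "'a::euclidean_space set \<Rightarrow> 'a set \<Rightarrow> bool" where
  "orthonormal_basis_of B V \<longleftrightarrow> pairwise orthogonal B \<and> (\<forall>e\<in>B. norm e = 1) \<and> span B = V"

definition has_divergence_S3 ::
    "(complex \<times> complex \<Rightarrow> complex \<times> complex) \<Rightarrow> real \<Rightarrow> complex \<times> complex \<Rightarrow> bool" where
  "has_divergence_S3 X d p \<longleftrightarrow>
     (\<exists>D. (X has_derivative D) (at p within S3) \<and>
          (\<forall>B. orthonormal_basis_of B (tangent_S3 p) \<longrightarrow> (\<Sum>e\<in>B. D e \<bullet> e) = d))"

definition divergence_free_S3 :: "(complex \<times> complex \<Rightarrow> complex \<times> complex) \<Rightarrow> bool" where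
  "divergence_free_S3 X \<longleftrightarrow> (\<forall>p\<in>S3. has_divergence_S3 X 0 p)"


section \<open>The standard contact structure\<close>

definition contact_form :: "complex \<times> complex \<Rightarrow> complex \<times> complex \<Rightarrow> real" where
  "contact_form p w = (case (p, w) of ((z1, z2), (w1, w2)) \<Rightarrow>
     - Im z1 * Re w1 + Re z1 * Im w1 - Im z2 * Re w2 + Re z2 * Im w2)"

definition legendrian :: "(complex \<times> complex \<Rightarrow> complex \<times> complex) \<Rightarrow> bool" where
  "legendrian X \<longleftrightarrow> (\<forall>p\<in>S3. X p \<in> tangent_S3 p \<and> contact_form p (X p) = 0)"

definition J :: "complex \<times> complex \<Rightarrow> complex \<times> complex" where
  "J w = (\<i> * fst w, \<i> * snd w)"

definition v1 :: "complex \<times> complex \<Rightarrow> complex \<times> complex" where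
  "v1 p = (case p of (z1, z2) \<Rightarrow> (Complex (- Re z2) (Im z2), Complex (Re z1) (- Im z1)))"

definition v2 :: "complex \<times> complex \<Rightarrow> complex \<times> complex" where
  "v2 p = (case p of (z1, z2) \<Rightarrow> (Complex (- Im z2) (- Re z2), Complex (Im z1) (Re z1)))"


section \<open>Bateman fields of Hopf type\<close>

definition holomorphic2_on :: "(complex \<times> complex \<Rightarrow> complex) \<Rightarrow> (complex \<times> complex) set \<Rightarrow> bool" where
  "holomorphic2_on h U \<longleftrightarrow>
     open U \<and> (\<forall>p\<in>U. \<exists>a b. (h has_derivative (\<lambda>w. a * fst w + b * snd w)) (at p))"

definition hopf_denom :: "real^3 \<Rightarrow> real \<Rightarrow> complex" where
  "hopf_denom r t =
     complex_of_real ((r$1)\<^sup>2 + (r$2)\<^sup>2 + (r$3)\<^sup>2) - (complex_of_real t - \<i>)\<^sup>2"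

definition hopf_alpha :: "real^3 \<Rightarrow> real \<Rightarrow> complex" where
  "hopf_alpha r t =
     (complex_of_real ((r$1)\<^sup>2 + (r$2)\<^sup>2 + (r$3)\<^sup>2 - t\<^sup>2 - 1) + 2 * \<i> * complex_of_real (r$3))
       / hopf_denom r t"

definition hopf_beta :: "real^3 \<Rightarrow> real \<Rightarrow> complex" where
  "hopf_beta r t =
     2 * (complex_of_real (r$1) - \<i> * complex_of_real (r$2)) / hopf_denom r t"

definition gradient :: "(real^3 \<Rightarrow> complex) \<Rightarrow> real^3 \<Rightarrow> complex^3" where
  "gradient f r = (\<chi> i. frechet_derivative f (at r) (axis i 1))"

text \<open>The library cross product is restricted to real vectors; this is its complex bilinear extension.\<close>

definition ccross :: "complex^3 \<Rightarrow> complex^3 \<Rightarrow> complex^3" where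
  "ccross a b = vector [a$2 * b$3 - a$3 * b$2, a$3 * b$1 - a$1 * b$3, a$1 * b$2 - a$2 * b$1]"

definition bateman_hopf_field ::
    "(complex \<times> complex \<Rightarrow> complex) \<Rightarrow> ((real^3) \<times> real \<Rightarrow> complex^3) \<Rightarrow> bool" where
  "bateman_hopf_field h F \<longleftrightarrow>
     (\<exists>U. S3 \<subseteq> U \<and> holomorphic2_on h U) \<and>
     (\<forall>r t. F (r, t) = h (hopf_alpha r t, hopf_beta r t) *s
        ccross (gradient (\<lambda>r. hopf_alpha r t) r) (gradient (\<lambda>r. hopf_beta r t) r))"

text \<open>
  Real and imaginary part of \<open>h (v1 + i v2)\<close>. This is a section of the complexified tangent
  bundle, where \<open>i\<close> is not \<open>J\<close>, so the two parts are real combinations of \<open>v1\<close> and \<open>v2\<close>.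
\<close>

definition legendrian_pair ::
    "(complex \<times> complex \<Rightarrow> complex) \<Rightarrow> complex \<times> complex \<Rightarrow>
       (complex \<times> complex) \<times> (complex \<times> complex)" where
  "legendrian_pair h p =
     (Re (h p) *\<^sub>R v1 p - Im (h p) *\<^sub>R v2 p, Im (h p) *\<^sub>R v1 p + Re (h p) *\<^sub>R v2 p)"

end

theory Submission
  imports Defs "HOL-Complex_Analysis.Conformal_Mappings"
begin

text \<open>
  A Legendrian field is \<open>E = cnj f v1\<close> for a unique function \<open>f\<close> on the sphere, and \<open>(E, J E)\<close> is the
  pair of \<open>h\<close> iff \<open>h = f\<close> on the sphere. As \<open>v1\<close> and \<open>v2\<close> are divergence-free, the divergences of
  \<open>E\<close> and \<open>J E\<close> are the real and imaginary part of \<open>(v1 + i v2) f\<close>. So both vanish iff \<open>f\<close>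
  satisfies the tangential Cauchy-Riemann equation, and the claim is that a real-analytic CR
  function extends holomorphically to a neighbourhood of the sphere.

  Near \<open>p\<close> write \<open>f(z) = F(z, cnj z)\<close> with \<open>F\<close> holomorphic on an open subset of \<open>\<complex>\<^sup>4\<close>; the extension is
  \<open>h(z) = F(z, cnj z / |z|^2)\<close>. For \<open>u\<close> in the sphere, \<open>\<lambda> \<mapsto> h(\<lambda> u) = F(\<lambda> u, cnj u / \<lambda>)\<close> is the
  holomorphic extension of \<open>f(\<lambda> u)\<close> from the unit circle, so \<open>h\<close> does not depend on the choice of \<open>F\<close>
  and \<open>p\<close>. The CR equation \<open>-z2 F_w1 + z1 F_w2 = 0\<close> holds at \<open>(\<lambda> u, cnj u / \<lambda>)\<close> for \<open>|\<lambda>| = 1\<close>, hence for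
  all \<open>\<lambda>\<close> near 1 by the identity theorem, and this makes the derivative of \<open>h\<close> complex linear.
\<close>

section \<open>Divergence of Legendrian fields\<close>

lemma orthonormal_finite:
  assumes "orthonormal_basis_of B V" shows "finite B"
proof -
  have "0 \<notin> B" "pairwise orthogonal B" using assms by (auto simp: orthonormal_basis_of_def)
  then show ?thesis using pairwise_orthogonal_independent independent_imp_finite by blast
qed

text \<open>Reduces the quantifier over all bases in \<open>has_divergence_S3\<close> to one frame.
  Only the second factor of \<open>D e \<bullet> e\<close> is expanded in the other basis, so
  \<open>D\<close> may leave \<open>V\<close>; swapping the double sum then reassembles
  \<open>D c\<close>.\<close>

lemma orthonormal_trace_eq:
  fixes D :: "'a::euclidean_space \<Rightarrow> 'a"
  assumes D: "linear D" and B: "orthonormal_basis_of B V" and C: "orthonormal_basis_of C V"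
  shows "(\<Sum>e\<in>B. D e \<bullet> e) = (\<Sum>e\<in>C. D e \<bullet> e)"
proof -
  have fin: "finite B" "finite C" using B C orthonormal_finite by auto
  have exB: "(\<Sum>e\<in>B. (x \<bullet> e) *\<^sub>R e) = x" if "x \<in> C" for x
    using that B C fin unfolding orthonormal_basis_of_def
    by (intro orthonormal_basis_expand) (auto intro: span_base)
  have exC: "(\<Sum>e\<in>C. (x \<bullet> e) *\<^sub>R e) = x" if "x \<in> B" for x
    using that B C fin unfolding orthonormal_basis_of_def
    by (intro orthonormal_basis_expand) (auto intro: span_base)
  have "(\<Sum>e\<in>B. D e \<bullet> e) = (\<Sum>e\<in>B. D e \<bullet> (\<Sum>c\<in>C. (e \<bullet> c) *\<^sub>R c))"
    using exC by (intro sum.cong) auto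
  also have "\<dots> = (\<Sum>e\<in>B. \<Sum>c\<in>C. (e \<bullet> c) * (D e \<bullet> c))"
    by (simp add: inner_sum_right)
  also have "\<dots> = (\<Sum>c\<in>C. \<Sum>e\<in>B. (e \<bullet> c) * (D e \<bullet> c))"
    by (rule sum.swap)
  also have "\<dots> = (\<Sum>c\<in>C. D (\<Sum>e\<in>B. (c \<bullet> e) *\<^sub>R e) \<bullet> c)"
    by (simp add: linear_sum[OF D] linear_cmul[OF D] inner_sum_left inner_sum_right inner_commute)
  also have "\<dots> = (\<Sum>c\<in>C. D c \<bullet> c)"
    using exB by (intro sum.cong) auto
  finally show ?thesis .
qed

section \<open>The Hopf frame and the divergence computed in it\<close>

lemma S3_iff_norm: "p \<in> S3 \<longleftrightarrow> norm p = 1"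
  by (cases p) (simp add: S3_def norm_Pair)

lemma v1_eq: "v1 p = (- cnj (snd p), cnj (fst p))"
  by (cases p) (simp add: v1_def complex_eq_iff)

lemma v2_eq: "v2 p = J (v1 p)"
  by (cases p) (simp add: v1_def v2_def J_def complex_eq_iff)

lemma inner_pair_complex:
  "(v :: complex \<times> complex) \<bullet> w = Re (fst v * cnj (fst w) + snd v * cnj (snd w))"
  by (cases v; cases w) (simp add: inner_complex_def)

lemma S3_iff: "p \<in> S3 \<longleftrightarrow> (cmod (fst p))\<^sup>2 + (cmod (snd p))\<^sup>2 = 1"
  by (cases p) (simp add: S3_def)

lemma S3_iff_coords:
  "p \<in> S3 \<longleftrightarrow> Re (fst p) * Re (fst p) + Im (fst p) * Im (fst p)
    + Re (snd p) * Re (snd p) + Im (snd p) * Im (snd p) = 1"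
  unfolding S3_iff cmod_power2 by (simp add: power2_eq_square algebra_simps)

lemma hopf_frame_inner:
  assumes "p \<in> S3"
  shows "J p \<bullet> p = 0" "v1 p \<bullet> p = 0" "v2 p \<bullet> p = 0" "J p \<bullet> v1 p = 0" "J p \<bullet> v2 p = 0"
    "v1 p \<bullet> v2 p = 0" "J p \<bullet> J p = 1" "v1 p \<bullet> v1 p = 1" "v2 p \<bullet> v2 p = 1"
  using assms
  unfolding S3_iff_coords by (simp_all add: inner_pair_complex v2_eq v1_eq J_def)

text \<open>\<open>J p\<close> is tangent to the Hopf fibre and completes \<open>v1\<close>,
  \<open>v2\<close>. The three vectors span by a dimension count, the tangent space being a
  hyperplane of real four-space.\<close>

lemma hopf_frame:
  assumes "p \<in> S3"
  shows "orthonormal_basis_of {J p, v1 p, v2 p} (tangent_S3 p)"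
    and "J p \<noteq> v1 p" "J p \<noteq> v2 p" "v1 p \<noteq> v2 p"
proof -
  note i = hopf_frame_inner[OF assms]
  show d: "J p \<noteq> v1 p" "J p \<noteq> v2 p" "v1 p \<noteq> v2 p"
    using i by (metis zero_neq_one)+
  have orth: "pairwise orthogonal {J p, v1 p, v2 p}"
    using i by (auto simp: pairwise_def orthogonal_def inner_commute)
  have norm: "\<forall>e\<in>{J p, v1 p, v2 p}. norm e = 1"
    using i by (auto simp: norm_eq_sqrt_inner)
  then have ind: "independent {J p, v1 p, v2 p}"
    using orth by (intro pairwise_orthogonal_independent) auto
  have sub: "{J p, v1 p, v2 p} \<subseteq> tangent_S3 p"
    using i by (auto simp: tangent_S3_def)
  have "p \<noteq> 0" using assms by (auto simp: S3_iff_norm)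
  then have "dim (tangent_S3 p) = 3"
    using dim_hyperplane[of p] by (simp add: tangent_S3_def inner_commute)
  then have "tangent_S3 p \<subseteq> span {J p, v1 p, v2 p}"
    using d ind sub by (intro card_ge_dim_independent) auto
  moreover have "span {J p, v1 p, v2 p} \<subseteq> tangent_S3 p"
    using sub by (intro span_minimal) (auto simp: tangent_S3_def subspace_def inner_add_left)
  ultimately show "orthonormal_basis_of {J p, v1 p, v2 p} (tangent_S3 p)"
    using orth norm by (auto simp: orthonormal_basis_of_def)
qed

text \<open>Differentiate along the curve \<open>s \<mapsto> cos s p + sin s w\<close> of the sphere.\<close>

lemma has_derivative_S3_unique:
  fixes X :: "complex \<times> complex \<Rightarrow> 'b::real_normed_vector"
  assumes p: "p \<in> S3" and w: "w \<in> tangent_S3 p"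
    and D1: "(X has_derivative D1) (at p within S3)" and D2: "(X has_derivative D2) (at p within S3)"
  shows "D1 w = D2 w"
proof -
  have lin: "linear D1" "linear D2" using D1 D2 has_derivative_linear by auto
  have unit: "D1 w = D2 w" if w: "w \<in> tangent_S3 p" and n: "norm w = 1" for w
  proof -
    define \<gamma> where "\<gamma> s = cos s *\<^sub>R p + sin s *\<^sub>R w" for s :: real
    have pp: "p \<bullet> p = 1" "w \<bullet> w = 1" "p \<bullet> w = 0"
      using p n w by (auto simp: S3_iff_norm dot_square_norm tangent_S3_def inner_commute)
    have "\<gamma> s \<bullet> \<gamma> s = 1" for s
    proof -
      have "\<gamma> s \<bullet> \<gamma> s = (cos s)\<^sup>2 + (sin s)\<^sup>2"
        unfolding \<gamma>_def using pp
        by (simp add: inner_add_left inner_add_right inner_commute power2_eq_square)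
      then show ?thesis by simp
    qed
    then have on: "\<gamma> s \<in> S3" for s by (simp add: S3_iff_norm norm_eq_1)
    have \<gamma>0: "\<gamma> 0 = p" by (simp add: \<gamma>_def)
    have d\<gamma>: "(\<gamma> has_derivative (\<lambda>s. s *\<^sub>R w)) (at 0)"
      unfolding \<gamma>_def by (auto intro!: derivative_eq_intros)
    \<comment> \<open>The curve never leaves \<open>S3\<close>, so a derivative within the sphere
      becomes an ordinary derivative at 0, where uniqueness holds.\<close>
    have d: "((\<lambda>s. X (\<gamma> s)) has_derivative (\<lambda>s. D (s *\<^sub>R w))) (at 0)"
      if "(X has_derivative D) (at p within S3)" for D
      using that on \<gamma>0
      by (intro has_derivative_in_compose[OF d\<gamma>]) (auto intro: has_derivative_subset)
    have "(\<lambda>s. D1 (s *\<^sub>R w)) = (\<lambda>s. D2 (s *\<^sub>R w))"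
      using has_derivative_unique[OF d[OF D1] d[OF D2]] .
    from fun_cong[OF this, of 1] show ?thesis by simp
  qed
  show ?thesis
  proof (cases "w = 0")
    case True then show ?thesis using lin by (simp add: linear_0)
  next
    case False
    let ?u = "(1 / norm w) *\<^sub>R w"
    have "D1 ?u = D2 ?u" using False w by (intro unit) (auto simp: tangent_S3_def)
    then show ?thesis using False lin by (simp add: linear_cmul)
  qed
qed

text \<open>The existential \<open>D\<close> and the arbitrary basis of the definition are both
  harmless: derivatives within the sphere agree on tangent vectors, and the trace does not depend on
  the basis.\<close>

lemma has_divergence_S3_iff:
  assumes p: "p \<in> S3" and D: "(X has_derivative D) (at p within S3)"
  shows "has_divergence_S3 X d p \<longleftrightarrow> D (J p) \<bullet> J p + D (v1 p) \<bullet> v1 p + D (v2 p) \<bullet> v2 p = d"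
proof -
  have sum: "(\<Sum>e\<in>{J p, v1 p, v2 p}. D' e \<bullet> e) = D (J p) \<bullet> J p + D (v1 p) \<bullet> v1 p + D (v2 p) \<bullet> v2 p"
    if "(X has_derivative D') (at p within S3)" for D'
  proof -
    have "D' e = D e" if "e \<in> {J p, v1 p, v2 p}" for e
      using that hopf_frame_inner[OF p] \<open>(X has_derivative D') (at p within S3)\<close> D p
      by (intro has_derivative_S3_unique[of p e X]) (auto simp: tangent_S3_def)
    then show ?thesis using hopf_frame[OF p] by simp
  qed
  show ?thesis
  proof
    assume "has_divergence_S3 X d p"
    then obtain D' where D': "(X has_derivative D') (at p within S3)"
      "(\<Sum>e\<in>{J p, v1 p, v2 p}. D' e \<bullet> e) = d"
      using hopf_frame(1)[OF p] unfolding has_divergence_S3_def by blast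
    then show "D (J p) \<bullet> J p + D (v1 p) \<bullet> v1 p + D (v2 p) \<bullet> v2 p = d"
      by (simp only: sum[OF D'(1)] flip: D'(2))
  next
    assume "D (J p) \<bullet> J p + D (v1 p) \<bullet> v1 p + D (v2 p) \<bullet> v2 p = d"
    then show "has_divergence_S3 X d p"
      unfolding has_divergence_S3_def
      using D sum[OF D] orthonormal_trace_eq[OF has_derivative_linear[OF D] _ hopf_frame(1)[OF p]]
      by auto
  qed
qed

text \<open>The field \<open>cnj f v1\<close> in complex notation, where \<open>v2 = i v1\<close>.\<close>

definition legendrian_field :: "(complex \<times> complex \<Rightarrow> complex) \<Rightarrow> complex \<times> complex \<Rightarrow> complex \<times> complex"
  where "legendrian_field f p = (- cnj (f p) * cnj (snd p), cnj (f p) * cnj (fst p))"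

text \<open>The terms that differentiate \<open>v1\<close> contribute nothing to the trace, nor does
  the direction \<open>J p\<close>. What is left is \<open>cnj (f' w)\<close> times
  \<open>v1 p\<close> paired with \<open>w = v1 p\<close> and with
  \<open>w = v2 p = J (v1 p)\<close>, which gives \<open>Re a\<close> and
  \<open>Re (\<i> * b)\<close>.\<close>

lemma has_divergence_legendrian_field:
  assumes p: "p \<in> S3" and f: "(f has_derivative f') (at p within S3)"
    and X: "\<And>q. q \<in> S3 \<Longrightarrow> X q = legendrian_field f q"
  shows "has_divergence_S3 X d p \<longleftrightarrow> Re (f' (v1 p) + \<i> * f' (v2 p)) = d"
proof -
  define D where "D w = (- cnj (f' w) * cnj (snd p) - cnj (f p) * cnj (snd w),
    cnj (f' w) * cnj (fst p) + cnj (f p) * cnj (fst w))" for w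
  have "(legendrian_field f has_derivative D) (at p within S3)"
    unfolding legendrian_field_def[abs_def] D_def
    by (rule derivative_eq_intros f refl has_derivative_ident)+ (auto simp: algebra_simps)
  then have D: "(X has_derivative D) (at p within S3)"
    using p X by (auto intro: has_derivative_transform)
  define a b where "a = f' (v1 p)" and "b = f' (v2 p)"
  have "D (J p) \<bullet> J p + D (v1 p) \<bullet> v1 p + D (v2 p) \<bullet> v2 p = Re (a + \<i> * b) * (Re (fst p) * Re (fst p) + Im (fst p) * Im (fst p)
      + Re (snd p) * Re (snd p) + Im (snd p) * Im (snd p))"
    unfolding D_def a_def[symmetric] b_def[symmetric]
    by (simp add: inner_pair_complex v2_eq v1_eq J_def algebra_simps)
  then show ?thesis using has_divergence_S3_iff[OF p D] p
    unfolding S3_iff_coords by (simp add: a_def b_def)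
qed

text \<open>Tangency and the contact condition are the real and imaginary part of one equation:
  \<open>X p\<close> is Hermitian orthogonal to \<open>p\<close>. Hence \<open>X p\<close> is a
  complex multiple of \<open>v1 p\<close>, and its coefficient is the Hermitian product with
  \<open>v1 p\<close>.\<close>

lemma legendrian_field_of_legendrian:
  assumes "legendrian X" and p: "p \<in> S3"
  shows "X p = legendrian_field (\<lambda>q. cnj (fst q * snd (X q) - snd q * fst (X q))) p"
proof -
  obtain z1 z2 w1 w2 where e: "p = (z1, z2)" "X p = (w1, w2)" by (metis surj_pair)
  have s: "z1 * cnj z1 + z2 * cnj z2 = 1"
    using p unfolding e S3_def by (simp add: complex_norm_square[symmetric] flip: of_real_add of_real_power)
  have "w1 * cnj z1 + w2 * cnj z2 = 0"
    using assms e by (auto simp: legendrian_def tangent_S3_def contact_form_def complex_eq_iff inner_complex_def algebra_simps)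
  then have "w1 * cnj z1 = - w2 * cnj z2" by (simp add: add_eq_0_iff)
  with s have "w1 = - (z1 * w2 - z2 * w1) * cnj z2" "w2 = (z1 * w2 - z2 * w1) * cnj z1"
    by algebra+
  then show ?thesis unfolding legendrian_field_def e(2) unfolding e(1) by simp
qed

text \<open>Since \<open>v2 = J v1\<close>, the real combination with coefficients
  \<open>Re h\<close> and \<open>- Im h\<close> is multiplication of \<open>v1\<close> by
  \<open>cnj h\<close>. This is the origin of the conjugate in
  \<open>legendrian_field\<close>.\<close>

lemma legendrian_pair_eq:
  "legendrian_pair h p = (legendrian_field h p, J (legendrian_field h p))"
  by (cases p) (simp add: legendrian_pair_def legendrian_field_def v1_def v2_def J_def complex_eq_iff)

lemma legendrian_field_inj:
  assumes "p \<in> S3" "legendrian_field f p = legendrian_field g p"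
  shows "f p = g p"
  using assms by (auto simp: legendrian_field_def S3_iff)

lemma J_legendrian_field: "J (legendrian_field f p) = legendrian_field (\<lambda>q. - \<i> * f q) p"
  by (simp add: J_def legendrian_field_def)

text \<open>Applying \<open>J\<close> multiplies \<open>f\<close> by \<open>- \<i>\<close>, so the
  divergence of \<open>B\<close> is the imaginary part of the expression whose real part is the
  divergence of \<open>E\<close>. The two real conditions form the tangential Cauchy-Riemann
  equation.\<close>

lemma divergence_free_pair_iff:
  assumes p: "p \<in> S3" and f: "(f has_derivative f') (at p within S3)"
    and E: "\<And>q. q \<in> S3 \<Longrightarrow> E q = legendrian_field f q" and B: "\<And>q. q \<in> S3 \<Longrightarrow> B q = J (E q)"
  shows "has_divergence_S3 E 0 p \<and> has_divergence_S3 B 0 p \<longleftrightarrow> f' (v1 p) + \<i> * f' (v2 p) = 0"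
proof -
  have "((\<lambda>q. - \<i> * f q) has_derivative (\<lambda>w. - \<i> * f' w)) (at p within S3)"
    by (rule has_derivative_mult_right[OF f])
  then have "has_divergence_S3 B 0 p \<longleftrightarrow> Re (- \<i> * f' (v1 p) + \<i> * (- \<i> * f' (v2 p))) = 0"
    using E B J_legendrian_field by (intro has_divergence_legendrian_field p) auto
  moreover have "has_divergence_S3 E 0 p \<longleftrightarrow> Re (f' (v1 p) + \<i> * f' (v2 p)) = 0"
    by (rule has_divergence_legendrian_field[OF p f E])
  ultimately show ?thesis by (auto simp: complex_eq_iff)
qed

section \<open>Holomorphic power series in several variables\<close>

text \<open>Closed under products of arbitrary polynomials and not restricted to monomials, because
  the terms of the complexified series are products of affine forms.\<close>

inductive cpoly :: "(complex^'n \<Rightarrow> complex) \<Rightarrow> bool" where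
  cpoly_const: "cpoly (\<lambda>_. c)"
| cpoly_nth: "cpoly (\<lambda>Z. Z $ j)"
| cpoly_add: "cpoly \<phi> \<Longrightarrow> cpoly \<psi> \<Longrightarrow> cpoly (\<lambda>Z. \<phi> Z + \<psi> Z)"
| cpoly_mult: "cpoly \<phi> \<Longrightarrow> cpoly \<psi> \<Longrightarrow> cpoly (\<lambda>Z. \<phi> Z * \<psi> Z)"

lemma cpoly_diff: "cpoly \<phi> \<Longrightarrow> cpoly \<psi> \<Longrightarrow> cpoly (\<lambda>Z. \<phi> Z - \<psi> Z)"
  using cpoly_add[of \<phi> "\<lambda>Z. (-1) * \<psi> Z"] cpoly_mult[OF cpoly_const[of "-1"], of \<psi>] by simp

lemma cpoly_power: "cpoly \<phi> \<Longrightarrow> cpoly (\<lambda>Z. \<phi> Z ^ m)"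
  by (induction m) (auto intro: cpoly.intros)

lemma cpoly_prod: "(\<And>b. b \<in> B \<Longrightarrow> cpoly (\<phi> b)) \<Longrightarrow> cpoly (\<lambda>Z. \<Prod>b\<in>B. \<phi> b Z)"
  by (induction B rule: infinite_finite_induct) (auto intro: cpoly.intros)

text \<open>The partial derivatives are again polynomials, so the differentiated series is also
  holomorphic along holomorphic curves.\<close>

lemma cpoly_has_derivative:
  fixes \<phi> :: "complex^'n \<Rightarrow> complex"
  assumes "cpoly \<phi>"
  shows "\<exists>a. (\<forall>j. cpoly (a j)) \<and> (\<forall>Z. (\<phi> has_derivative (\<lambda>V. \<Sum>j\<in>UNIV. a j Z * V $ j)) (at Z))"
  using assms
proof induction
  case (cpoly_const c)
  show ?case by (intro exI[of _ "\<lambda>_ _. 0"]) (auto intro: cpoly.intros)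
next
  case (cpoly_nth j)
  have "((\<lambda>Z. Z $ j) has_derivative (\<lambda>V. \<Sum>i\<in>UNIV. (if i = j then 1 else 0) * V $ i)) (at Z)"
    for Z :: "complex^'n"
    by (simp add: if_distrib[of "\<lambda>x. x * _"] cong: if_cong)
      (rule bounded_linear_imp_has_derivative[OF bounded_linear_vec_nth])
  then show ?case
    by (intro exI[of _ "\<lambda>i _. if i = j then 1 else 0"]) (auto intro: cpoly.intros)
next
  case (cpoly_add \<phi> \<psi>)
  then obtain a b where ab: "\<And>j. cpoly (a j)" "\<And>j. cpoly (b j)"
    "\<And>Z. (\<phi> has_derivative (\<lambda>V. \<Sum>j\<in>UNIV. a j Z * V $ j)) (at Z)"
    "\<And>Z. (\<psi> has_derivative (\<lambda>V. \<Sum>j\<in>UNIV. b j Z * V $ j)) (at Z)" by blast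
  have "((\<lambda>Z. \<phi> Z + \<psi> Z) has_derivative (\<lambda>V. \<Sum>j\<in>UNIV. (a j Z + b j Z) * V $ j)) (at Z)" for Z
    using has_derivative_add[OF ab(3,4)] by (simp add: sum.distrib distrib_right)
  then show ?case
    using ab by (intro exI[of _ "\<lambda>j Z. a j Z + b j Z"]) (auto intro: cpoly.intros)
next
  case (cpoly_mult \<phi> \<psi>)
  then obtain a b where ab: "\<And>j. cpoly (a j)" "\<And>j. cpoly (b j)"
    "\<And>Z. (\<phi> has_derivative (\<lambda>V. \<Sum>j\<in>UNIV. a j Z * V $ j)) (at Z)"
    "\<And>Z. (\<psi> has_derivative (\<lambda>V. \<Sum>j\<in>UNIV. b j Z * V $ j)) (at Z)" by blast
  have "((\<lambda>Z. \<phi> Z * \<psi> Z) has_derivative (\<lambda>V. \<Sum>j\<in>UNIV. (\<phi> Z * b j Z + a j Z * \<psi> Z) * V $ j)) (at Z)" for Z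
    using has_derivative_mult[OF ab(3,4)]
    by (simp add: sum.distrib distrib_left sum_distrib_left sum_distrib_right mult_ac)
  moreover have "cpoly (\<lambda>Z. \<phi> Z * b j Z + a j Z * \<psi> Z)" for j
    by (intro cpoly.cpoly_add cpoly.cpoly_mult cpoly_mult.hyps ab)
  ultimately show ?case
    by (intro exI[of _ "\<lambda>j Z. \<phi> Z * b j Z + a j Z * \<psi> Z"] conjI allI)
qed

lemma cpoly_holomorphic_on:
  assumes "cpoly \<phi>" "\<And>j. (\<lambda>t. \<gamma> t $ j) holomorphic_on S"
  shows "(\<lambda>t. \<phi> (\<gamma> t)) holomorphic_on S"
  using assms by induction (auto intro!: holomorphic_intros)

section \<open>Cauchy estimates and termwise differentiation\<close>

lemma norm_axis_complex: "norm (axis j t :: complex^'n) = norm t"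
proof -
  have "norm (axis j t :: complex^'n) = L2_set (\<lambda>i. if i = j then norm t else 0) UNIV"
    by (auto simp: norm_vec_def axis_def intro!: L2_set_cong)
  also have "\<dots> = norm t"
    by (simp add: L2_set_def if_distrib[of "\<lambda>x. x\<^sup>2"] cong: if_cong)
  finally show ?thesis .
qed

lemma bounded_linear_axis: "bounded_linear (axis j :: complex \<Rightarrow> complex^'n)"
  by (rule bounded_linear_intro[of _ 1]) (simp_all add: norm_axis_complex, simp_all add: vec_eq_iff axis_def)

lemma has_derivative_vec_lambda:
  fixes f :: "'n::finite \<Rightarrow> 'a::real_normed_vector \<Rightarrow> complex"
  assumes "\<And>j. (f j has_derivative f' j) F"
  shows "((\<lambda>x. \<chi> j. f j x) has_derivative (\<lambda>w. \<chi> j. f' j w)) F"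
proof -
  have e: "(\<chi> j. g j) = (\<Sum>j\<in>UNIV. axis j (g j))" for g :: "'n \<Rightarrow> complex"
    by (simp add: vec_eq_iff axis_def if_distrib cong: if_cong)
  show ?thesis unfolding e
    by (intro has_derivative_sum bounded_linear.has_derivative[OF bounded_linear_axis] assms)
qed

text \<open>Cauchy's inequality in the \<open>j\<close>-th variable, on a circle of radius
  \<open>R / 2\<close> about \<open>Z\<close>. From the half ball this circle stays in the ball of
  radius \<open>R\<close>.\<close>

lemma partial_derivative_bound:
  fixes Z0 :: "complex^'n"
  assumes "cpoly \<phi>" and a: "(\<phi> has_derivative (\<lambda>V. \<Sum>j\<in>UNIV. a j * V $ j)) (at Z)"
    and Z: "Z \<in> ball Z0 (R / 2)" and bound: "\<And>Z. Z \<in> ball Z0 R \<Longrightarrow> norm (\<phi> Z) \<le> K"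
  shows "norm (a j) \<le> 2 * K / R"
proof -
  have R: "R > 0" using Z zero_le_dist[of Z0 Z] by (simp del: zero_le_dist)
  define g where "g t = \<phi> (Z + axis j t)" for t
  have holo: "g holomorphic_on S" for S
    unfolding g_def
  proof (rule cpoly_holomorphic_on[OF assms(1)])
    show "(\<lambda>t. (Z + axis j t) $ k) holomorphic_on S" for k
      by (cases "k = j") (auto simp: axis_def intro!: holomorphic_intros)
  qed
  have "((\<lambda>t. Z + axis j t) has_derivative axis j) (at 0)"
    using has_derivative_add[OF has_derivative_const
        bounded_linear_imp_has_derivative[OF bounded_linear_axis]] by simp
  from has_derivative_compose[OF this, of \<phi>] a
  have "(g has_derivative (\<lambda>t. \<Sum>i\<in>UNIV. a i * axis j t $ i)) (at 0)"
    unfolding g_def by (simp add: axis_eq_0_iff[THEN iffD2])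
  moreover have "(\<lambda>t. \<Sum>i\<in>UNIV. a i * axis j t $ i) = (*) (a j)"
    by (auto simp: axis_def if_distrib cong: if_cong)
  ultimately have "deriv g 0 = a j"
    by (intro DERIV_imp_deriv) (simp add: has_field_derivative_def)
  moreover have "norm ((deriv ^^ 1) g 0) \<le> fact 1 * K / (R / 2) ^ 1"
  proof (rule Cauchy_inequality)
    show "norm (g t) \<le> K" if "norm (0 - t) = R / 2" for t
    proof -
      have "dist Z0 (Z + axis j t) \<le> dist Z0 Z + dist Z (Z + axis j t)" by (rule dist_triangle)
      also have "\<dots> < R" using Z that by (simp add: dist_norm norm_axis_complex)
      finally show ?thesis unfolding g_def by (intro bound) simp
    qed
  qed (use R holo in \<open>auto intro: holomorphic_on_imp_continuous_on\<close>)
  ultimately show ?thesis by (simp add: field_simps)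
qed

lemma holomorphic_on_suminf:
  assumes "open S" and f: "\<And>n. f n holomorphic_on S"
    and bound: "\<And>n t. t \<in> S \<Longrightarrow> norm (f n t) \<le> M n" and "summable M"
  shows "(\<lambda>t. \<Sum>n. f n t) holomorphic_on S"
proof (rule holomorphic_uniform_sequence[OF \<open>open S\<close>])
  show "(\<lambda>t. \<Sum>i<n. f i t) holomorphic_on S" for n
    using f by (intro holomorphic_intros)
next
  fix x assume "x \<in> S"
  then obtain d where d: "d > 0" "cball x d \<subseteq> S" using \<open>open S\<close> open_contains_cball by blast
  have "uniform_limit (cball x d) (\<lambda>n t. \<Sum>i<n. f i t) (\<lambda>t. \<Sum>n. f n t) sequentially"
    using d bound \<open>summable M\<close> by (intro Weierstrass_m_test) blast+
  then show "\<exists>d>0. cball x d \<subseteq> S \<and> uniform_limit (cball x d) (\<lambda>n t. \<Sum>i<n. f i t) (\<lambda>t. \<Sum>n. f n t) sequentially"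
    using d by blast
qed

text \<open>On the half ball the derivatives have the summable majorant \<open>2 * K n / R\<close>,
  so the series may be differentiated termwise. Holomorphy is recorded only along one-variable
  curves, which is what the identity theorem needs later.\<close>

lemma cpoly_series:
  fixes \<phi> :: "nat \<Rightarrow> complex^'n \<Rightarrow> complex"
  assumes poly: "\<And>n. cpoly (\<phi> n)" and R: "R > 0"
    and bound: "\<And>n Z. Z \<in> ball Z0 R \<Longrightarrow> norm (\<phi> n Z) \<le> K n" and K: "summable K"
  obtains A where
    "\<forall>Z\<in>ball Z0 (R / 2).
      ((\<lambda>Z. \<Sum>n. \<phi> n Z) has_derivative (\<lambda>V. \<Sum>j\<in>UNIV. A j Z * V $ j)) (at Z)"
    "\<forall>S \<gamma>. open S \<longrightarrow> (\<forall>j. (\<lambda>t. \<gamma> t $ j) holomorphic_on S) \<longrightarrow> \<gamma> ` S \<subseteq> ball Z0 (R / 2) \<longrightarrow>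
      (\<lambda>t. \<Sum>n. \<phi> n (\<gamma> t)) holomorphic_on S \<and> (\<forall>j. (\<lambda>t. A j (\<gamma> t)) holomorphic_on S)"
proof -
  let ?B = "ball Z0 (R / 2)"
  have "\<forall>n. \<exists>a. (\<forall>j. cpoly (a j)) \<and>
      (\<forall>Z. (\<phi> n has_derivative (\<lambda>V. \<Sum>j\<in>UNIV. a j Z * V $ j)) (at Z))"
    using cpoly_has_derivative[OF poly] by blast
  from choice[OF this] obtain a where a: "\<And>n j. cpoly (a n j)"
    "\<And>n Z. (\<phi> n has_derivative (\<lambda>V. \<Sum>j\<in>UNIV. a n j Z * V $ j)) (at Z)"
    by blast
  have a_bound: "norm (a n j Z) \<le> 2 * K n / R" if "Z \<in> ?B" for n j Z
    using partial_derivative_bound[OF poly a(2) that bound] by blast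
  have sum_a: "summable (\<lambda>n. 2 * K n / R)"
    using K by (intro summable_divide summable_mult)
  define A where "A j Z = (\<Sum>n. a n j Z)" for j Z
  have lim: "uniform_limit ?B (\<lambda>n Z. \<Sum>i<n. a i j Z) (A j) sequentially" for j
    unfolding A_def using a_bound sum_a by (intro Weierstrass_m_test)
  have "\<forall>\<^sub>F n in sequentially. \<forall>Z\<in>?B. \<forall>V.
      norm ((\<Sum>i<n. \<Sum>j\<in>UNIV. a i j Z * V $ j) - (\<Sum>j\<in>UNIV. A j Z * V $ j)) \<le> e * norm V"
    if e: "e > 0" for e
  proof -
    \<comment> \<open>The errors in the \<open>CARD('n)\<close> coordinates add up to
      \<open>e\<close>.\<close>
    define d where "d = e / real CARD('n)"
    have "d > 0" using e by (simp add: d_def)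
    then have "\<forall>\<^sub>F n in sequentially. \<forall>j\<in>UNIV. \<forall>Z\<in>?B. norm ((\<Sum>i<n. a i j Z) - A j Z) < d"
      using lim by (intro eventually_ball_finite) (auto simp: uniform_limit_iff dist_norm)
    then show ?thesis
    proof eventually_elim
      case (elim n)
      show ?case
      proof (intro ballI allI)
        fix Z V assume Z: "Z \<in> ?B"
        have "(\<Sum>i<n. \<Sum>j\<in>UNIV. a i j Z * V $ j) - (\<Sum>j\<in>UNIV. A j Z * V $ j)
            = (\<Sum>j\<in>UNIV. ((\<Sum>i<n. a i j Z) - A j Z) * V $ j)"
          by (subst sum.swap) (simp add: sum_distrib_right left_diff_distrib sum_subtractf)
        also have "norm \<dots> \<le> (\<Sum>j\<in>(UNIV::'n set). d * norm V)"
        proof (rule sum_norm_le)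
          fix j
          have "norm ((\<Sum>i<n. a i j Z) - A j Z) \<le> d" using elim Z by (auto intro: less_imp_le)
          then show "norm (((\<Sum>i<n. a i j Z) - A j Z) * V $ j) \<le> d * norm V"
            unfolding norm_mult using \<open>d > 0\<close> by (intro mult_mono Finite_Cartesian_Product.norm_nth_le) auto
        qed
        also have "\<dots> = e * norm V" by (simp add: d_def)
        finally show "norm ((\<Sum>i<n. \<Sum>j\<in>UNIV. a i j Z * V $ j) - (\<Sum>j\<in>UNIV. A j Z * V $ j)) \<le> e * norm V" .
      qed
    qed
  qed
  note conv = this
  have "summable (\<lambda>n. \<phi> n Z0)"
    by (rule summable_comparison_test'[OF K, of 0]) (simp add: bound R)
  then have sums0: "(\<lambda>n. \<phi> n Z0) sums (\<Sum>n. \<phi> n Z0)" by (rule summable_sums)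
  have "\<exists>g. \<forall>Z\<in>?B. (\<lambda>n. \<phi> n Z) sums g Z \<and>
      (g has_derivative (\<lambda>V. \<Sum>j\<in>UNIV. A j Z * V $ j)) (at Z within ?B)"
  proof (rule has_derivative_series[where f = \<phi> and x = Z0 and l = "\<Sum>n. \<phi> n Z0"
        and f' = "\<lambda>n Z V. \<Sum>j\<in>UNIV. a n j Z * V $ j", OF convex_ball _ _ _ sums0])
    show "Z0 \<in> ?B" using R by simp
    show "(\<phi> n has_derivative (\<lambda>V. \<Sum>j\<in>UNIV. a n j Z * V $ j)) (at Z within ?B)" for n Z
      by (rule has_derivative_at_withinI[OF a(2)])
  qed (rule conv)
  then obtain g where g: "\<forall>Z\<in>?B. (\<lambda>n. \<phi> n Z) sums g Z \<and>
      (g has_derivative (\<lambda>V. \<Sum>j\<in>UNIV. A j Z * V $ j)) (at Z within ?B)" by (rule exE)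
  have deriv: "((\<lambda>Z. \<Sum>n. \<phi> n Z) has_derivative (\<lambda>V. \<Sum>j\<in>UNIV. A j Z * V $ j)) (at Z)" if Z: "Z \<in> ?B" for Z
  proof (rule has_derivative_transform_within_open[OF _ open_ball Z])
    show "(g has_derivative (\<lambda>V. \<Sum>j\<in>UNIV. A j Z * V $ j)) (at Z)"
      using bspec[OF g Z] at_within_open[OF Z open_ball] by simp
    show "g Z' = (\<Sum>n. \<phi> n Z')" if "Z' \<in> ?B" for Z'
      using bspec[OF g that] by (simp add: sums_iff)
  qed
  have A_holo: "(\<lambda>t. A j (\<gamma> t)) holomorphic_on S"
    if S: "open S" "\<And>j. (\<lambda>t. \<gamma> t $ j) holomorphic_on S" "\<gamma> ` S \<subseteq> ?B" for S \<gamma> j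
    unfolding A_def
  proof (rule holomorphic_on_suminf[OF S(1) _ _ sum_a])
    show "(\<lambda>t. a n j (\<gamma> t)) holomorphic_on S" for n
      using a(1) S(2) by (rule cpoly_holomorphic_on)
    show "norm (a n j (\<gamma> t)) \<le> 2 * K n / R" if "t \<in> S" for n t
      using a_bound S(3) that by blast
  qed
  have F_holo: "(\<lambda>t. \<Sum>n. \<phi> n (\<gamma> t)) holomorphic_on S"
    if S: "open S" "\<And>j. (\<lambda>t. \<gamma> t $ j) holomorphic_on S" "\<gamma> ` S \<subseteq> ?B" for S \<gamma>
  proof (rule holomorphic_on_suminf[OF S(1) _ _ K])
    show "(\<lambda>t. \<phi> n (\<gamma> t)) holomorphic_on S" for n
      using poly S(2) by (rule cpoly_holomorphic_on)
    have "?B \<subseteq> ball Z0 R" using R by (intro subset_ball) simp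
    then show "norm (\<phi> n (\<gamma> t)) \<le> K n" if "t \<in> S" for n t
      using bound S(3) that by blast
  qed
  show thesis
    by (rule that[of A]; intro ballI allI impI conjI)
      (use deriv in blast, (rule F_holo A_holo; blast)+)
qed

section \<open>Complexification\<close>

text \<open>Coordinates 3 and 4 are independent variables in place of the conjugates; the real
  points are those of the form \<open>lift4 z (cnj2 z)\<close>.\<close>

definition lift4 :: "complex \<times> complex \<Rightarrow> complex \<times> complex \<Rightarrow> complex^4" where
  "lift4 z w = (\<chi> j. if j = 1 then fst z else if j = 2 then snd z else if j = 3 then fst w else snd w)"

definition cnj2 :: "complex \<times> complex \<Rightarrow> complex \<times> complex" where
  "cnj2 z = (cnj (fst z), cnj (snd z))"

lemma lift4_nth [simp]:
  "lift4 z w $ 1 = fst z" "lift4 z w $ 2 = snd z" "lift4 z w $ 3 = fst w" "lift4 z w $ 4 = snd w"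
  by (simp_all add: lift4_def)

text \<open>Each real coordinate is half of \<open>z * cnj b + cnj z * b\<close>, summed over the
  two components, and is polynomial once \<open>cnj z\<close> is freed. The expansion is not of
  \<open>g\<close> but of the coefficient found in
  \<open>legendrian_field_of_legendrian\<close>.\<close>

lemma real_analytic_at_complexify:
  assumes "real_analytic_at g p"
  obtains \<phi> R K where "\<And>n. cpoly (\<phi> n)" "R > 0" "summable K"
    "\<And>n Z. Z \<in> ball (lift4 p (cnj2 p)) R \<Longrightarrow> norm (\<phi> n Z) \<le> K n"
    "\<And>z. lift4 z (cnj2 z) \<in> ball (lift4 p (cnj2 p)) R \<Longrightarrow>
      (\<lambda>n. \<phi> n (lift4 z (cnj2 z))) sums cnj (fst z * snd (g z) - snd z * fst (g z))"
proof -
  let ?Z0 = "lift4 p (cnj2 p)"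
  define I :: "(complex \<times> complex \<Rightarrow> nat) set" where "I = Basis \<rightarrow>\<^sub>E UNIV"
  from assms obtain c r where r: "0 < r" and c: "\<And>x. x \<in> ball p r \<Longrightarrow>
      ((\<lambda>m. (\<Prod>b\<in>Basis. ((x - p) \<bullet> b) ^ m b) *\<^sub>R c m) has_sum g x) I"
    unfolding real_analytic_at_def I_def by blast
  \<comment> \<open>The basis has four vectors, so the point \<open>x\<close> below is at distance
    at most \<open>4 * \<rho> = r / 2\<close> from \<open>p\<close>.\<close>
  define \<rho> where "\<rho> = r / 8"
  have \<rho>: "\<rho> > 0" using r by (simp add: \<rho>_def)
  define k where "k m = (\<Prod>b\<in>(Basis :: (complex \<times> complex) set). \<rho> ^ m b)" for m
  have k0: "k m \<ge> 0" for m using \<rho> by (auto simp: k_def intro!: prod_nonneg)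
  \<comment> \<open>All displacements of \<open>x\<close> equal \<rho>, so the monomial of
    \<open>m\<close> has the value \<open>k m\<close> there. Unconditional convergence at this
    single point is absolute and supplies the majorant for the complex ball.\<close>
  define x where "x = p + (\<Sum>b\<in>Basis. \<rho> *\<^sub>R b)"
  have "norm (x - p) \<le> (\<Sum>b\<in>(Basis :: (complex \<times> complex) set). \<rho>)"
    unfolding x_def add_diff_cancel_left' using \<rho> by (intro sum_norm_le) auto
  also have "\<dots> < r" using r by (simp add: \<rho>_def)
  finally have x: "x \<in> ball p r" by (simp add: dist_norm norm_minus_commute)
  have "(x - p) \<bullet> b = \<rho>" if "b \<in> Basis" for b
    using that by (simp add: x_def inner_sum_left_Basis)
  then have kc: "((\<lambda>m. k m *\<^sub>R c m) has_sum g x) I"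
    using c[OF x] by (simp add: k_def)
  have "(\<lambda>m. k m * cmod (fst (c m))) summable_on I" "(\<lambda>m. k m * cmod (snd (c m))) summable_on I"
    using has_sum_bounded_linear[OF bounded_linear_fst kc] has_sum_bounded_linear[OF bounded_linear_snd kc] k0
    by (auto simp: has_sum_imp_summable summable_on_iff_abs_summable_on_complex dest!: has_sum_imp_summable)
  then have kc': "(\<lambda>m. k m * (cmod (fst (c m)) + cmod (snd (c m)))) summable_on I"
    by (simp add: distrib_left summable_on_add)
  have "countable I" unfolding I_def by (intro countable_PiE) auto
  moreover obtain b :: "complex \<times> complex" where "b \<in> Basis" using nonempty_Basis by blast
  then have "infinite I"
    unfolding I_def by (cases b) (auto simp: finite_PiE_iff PiE_eq_empty_iff)
  ultimately obtain e where e: "bij_betw e (UNIV :: nat set) I"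
    using bij_betw_from_nat_into by blast
  \<comment> \<open>Four terms of size at most \<open>R\<close>, with the factor 1/2 in
    \<open>X\<close>, give the bound \<rho> on \<open>X\<close>.\<close>
  define R where "R = \<rho> / 2"
  have R: "R > 0" using \<rho> by (simp add: R_def)
  \<comment> \<open>The real coordinate \<open>(z - p) \<bullet> b\<close>, with \<open>cnj z\<close> replaced by an independent variable.\<close>
  define X where "X b Z = (Z $ 1 * cnj (fst b) + Z $ 2 * cnj (snd b) + Z $ 3 * fst b + Z $ 4 * snd b) * (1 / 2) - of_real (p \<bullet> b)"
    for b and Z :: "complex^4"
  have X_real: "X b (lift4 z (cnj2 z)) = of_real ((z - p) \<bullet> b)" for b z
    by (cases b; cases z) (simp add: X_def cnj2_def inner_diff_left complex_eq_iff inner_complex_def algebra_simps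
        diff_divide_distrib add_divide_distrib)
  have X_bound: "norm (X b Z) \<le> \<rho>" if "b \<in> Basis" "Z \<in> ball ?Z0 R" for b Z
  proof -
    define V where "V = Z - ?Z0"
    have V: "norm V < R" using that(2) by (simp add: V_def dist_norm norm_minus_commute)
    have b: "norm (fst b) \<le> 1" "norm (snd b) \<le> 1"
      using that(1) norm_fst_le[of "fst b" "snd b"] norm_snd_le[of "snd b" "fst b"] by auto
    have *: "norm (V $ j * w) \<le> R" if "norm w \<le> 1" for j w
      using mult_mono[of "norm (V $ j)" R "norm w" 1] that V R
        order_trans[OF Finite_Cartesian_Product.norm_nth_le[of V j] less_imp_le[OF V]]
      by (simp add: norm_mult)
    \<comment> \<open>The affine form \<open>X b\<close> vanishes at the centre, so only its linear
      part at \<open>V\<close> has to be estimated.\<close>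
    have "X b Z = X b Z - X b ?Z0" by (simp add: X_real)
    also have "\<dots> = (V $ 1 * cnj (fst b) + V $ 2 * cnj (snd b) + V $ 3 * fst b + V $ 4 * snd b) * (1 / 2)"
      by (simp add: X_def V_def algebra_simps)
    also have "norm \<dots> \<le> (norm (V $ 1 * cnj (fst b)) + norm (V $ 2 * cnj (snd b)) + norm (V $ 3 * fst b) + norm (V $ 4 * snd b)) * (1 / 2)"
      unfolding norm_mult[of _ "1/2"]
      by (intro mult_mono order_trans[OF norm_triangle_ineq] add_mono order_refl) auto
    also have "\<dots> \<le> (R + R + R + R) * (1 / 2)"
      using b by (intro mult_right_mono add_mono *) auto
    also have "\<dots> = \<rho>" by (simp add: R_def)
    finally show ?thesis .
  qed
  \<comment> \<open>Conjugating the coefficient turns \<open>fst z\<close> and \<open>snd z\<close>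
    into variables 3 and 4 and conjugates \<open>c m\<close>; the monomials are real at real points
    and do not change.\<close>
  define \<psi> where "\<psi> m Z = (Z $ 3 * cnj (snd (c m)) - Z $ 4 * cnj (fst (c m))) * (\<Prod>b\<in>Basis. X b Z ^ m b)"
    for m and Z :: "complex^4"
  define C where "C = norm ?Z0 + R"
  have C: "C \<ge> 0" using R by (simp add: C_def)
  define K where "K m = C * (k m * (cmod (fst (c m)) + cmod (snd (c m))))" for m
  show thesis
  proof (rule that[of "\<lambda>n. \<psi> (e n)" R "\<lambda>n. K (e n)"])
    show "cpoly (\<psi> (e n))" for n
      unfolding \<psi>_def X_def by (intro cpoly.intros cpoly_diff cpoly_prod cpoly_power)
    have "K summable_on I" unfolding K_def using kc' by (rule summable_on_cmult_right)
    then have "(\<lambda>n. K (e n)) summable_on UNIV" using summable_on_reindex_bij_betw[OF e] by blast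
    then show "summable (\<lambda>n. K (e n))" by (rule summable_on_imp_summable)
    show "norm (\<psi> (e n) Z) \<le> K (e n)" if Z: "Z \<in> ball ?Z0 R" for n Z
    proof -
      have "norm Z \<le> C"
        using Z norm_triangle_sub[of Z ?Z0] by (simp add: C_def dist_norm norm_minus_commute)
      then have ZC: "norm (Z $ j) \<le> C" for j
        using Finite_Cartesian_Product.norm_nth_le order_trans by blast
      have "norm (Z $ 3 * cnj (snd (c m)) - Z $ 4 * cnj (fst (c m)))
          \<le> C * cmod (snd (c m)) + C * cmod (fst (c m))" for m
        using ZC by (intro order_trans[OF norm_triangle_ineq4] add_mono) (auto simp: norm_mult intro!: mult_right_mono)
      moreover have "norm (\<Prod>b\<in>Basis. X b Z ^ m b) \<le> k m" for m
        unfolding k_def prod_norm[symmetric] norm_power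
        using X_bound Z by (intro prod_mono conjI power_mono) auto
      ultimately have "norm (\<psi> m Z) \<le> (C * cmod (snd (c m)) + C * cmod (fst (c m))) * k m" for m
        unfolding \<psi>_def norm_mult[of _ "prod _ _"] using C k0 by (intro mult_mono) auto
      then show ?thesis by (simp add: K_def algebra_simps)
    qed
    show "(\<lambda>n. \<psi> (e n) (lift4 z (cnj2 z))) sums cnj (fst z * snd (g z) - snd z * fst (g z))"
      if z: "lift4 z (cnj2 z) \<in> ball ?Z0 R" for z
    proof -
      have "norm (fst z - fst p) < R" "norm (snd z - snd p) < R"
        using z Finite_Cartesian_Product.norm_nth_le[of "lift4 z (cnj2 z) - ?Z0" 1]
          Finite_Cartesian_Product.norm_nth_le[of "lift4 z (cnj2 z) - ?Z0" 2]
        by (auto simp: dist_norm norm_minus_commute)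
      then have "norm (z - p) < R + R"
        using norm_Pair_le[of "fst z - fst p" "snd z - snd p"] by (simp add: minus_prod_def)
      then have "z \<in> ball p r" using r by (simp add: dist_norm norm_minus_commute R_def \<rho>_def)
      moreover have "bounded_linear (\<lambda>v. cnj (fst z * snd v - snd z * fst v))"
        by (intro bounded_linear_compose[OF bounded_linear_cnj] bounded_linear_sub
            bounded_linear_const_mult bounded_linear_fst bounded_linear_snd)
      ultimately have "((\<lambda>m. cnj (fst z * snd ((\<Prod>b\<in>Basis. ((z - p) \<bullet> b) ^ m b) *\<^sub>R c m)
          - snd z * fst ((\<Prod>b\<in>Basis. ((z - p) \<bullet> b) ^ m b) *\<^sub>R c m)))
          has_sum cnj (fst z * snd (g z) - snd z * fst (g z))) I"
        using has_sum_bounded_linear c by blast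
      moreover have "cnj (fst z * snd ((\<Prod>b\<in>Basis. ((z - p) \<bullet> b) ^ m b) *\<^sub>R c m)
          - snd z * fst ((\<Prod>b\<in>Basis. ((z - p) \<bullet> b) ^ m b) *\<^sub>R c m)) = \<psi> m (lift4 z (cnj2 z))" for m
        unfolding \<psi>_def X_real by (simp add: cnj2_def scaleR_conv_of_real algebra_simps)
      ultimately have "((\<lambda>m. \<psi> m (lift4 z (cnj2 z))) has_sum cnj (fst z * snd (g z) - snd z * fst (g z))) I"
        by simp
      then have "((\<lambda>n. \<psi> (e n) (lift4 z (cnj2 z))) has_sum cnj (fst z * snd (g z) - snd z * fst (g z))) UNIV"
        using has_sum_reindex_bij_betw[OF e, of "\<lambda>m. \<psi> m (lift4 z (cnj2 z))"] by simp
      then show ?thesis by (rule has_sum_imp_sums)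
    qed
  qed (rule R)
qed

section \<open>Complexified Hopf circles\<close>

definition cscale :: "complex \<Rightarrow> complex \<times> complex \<Rightarrow> complex \<times> complex" where
  "cscale \<mu> z = (\<mu> * fst z, \<mu> * snd z)"

text \<open>Holomorphic in \<mu> away from 0. For \<open>norm \<mu> = 1\<close> the factor
  \<open>1 / \<mu>\<close> is \<open>cnj \<mu>\<close>, so the curve runs through real points over
  the circle of \<open>u\<close>.\<close>

definition ray :: "complex \<times> complex \<Rightarrow> complex \<Rightarrow> complex^4" where
  "ray u \<mu> = lift4 (cscale \<mu> u) (cscale (1 / \<mu>) (cnj2 u))"

lemma cscale_S3: "norm \<mu> = 1 \<Longrightarrow> u \<in> S3 \<Longrightarrow> cscale \<mu> u \<in> S3"
  by (simp add: S3_iff cscale_def norm_mult)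

lemma ray_unit:
  assumes "norm \<mu> = 1"
  shows "ray u \<mu> = lift4 (cscale \<mu> u) (cnj2 (cscale \<mu> u))"
proof -
  have "cnj \<mu> * \<mu> = 1"
    using assms complex_norm_square[of \<mu>] by (simp add: mult.commute)
  moreover from assms have "\<mu> \<noteq> 0" by auto
  ultimately have "1 / \<mu> = cnj \<mu>" by (simp add: divide_eq_eq)
  then show ?thesis by (simp add: ray_def cscale_def cnj2_def)
qed

lemma holomorphic_on_ray:
  assumes "0 \<notin> S"
  shows "(\<lambda>t. ray u t $ j) holomorphic_on S"
proof -
  have "(\<lambda>t. t * a) holomorphic_on S" "(\<lambda>t. a / t) holomorphic_on S" for a
    using assms by (intro holomorphic_intros; blast)+
  then show ?thesis
    unfolding ray_def lift4_def cscale_def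
    by (cases "j = 1"; cases "j = 2"; cases "j = 3") simp_all
qed

lemma lift4_has_derivative:
  assumes "(f has_derivative f') F" "(g has_derivative g') F"
  shows "((\<lambda>x. lift4 (f x) (g x)) has_derivative (\<lambda>w. lift4 (f' w) (g' w))) F"
  unfolding lift4_def
proof (rule has_derivative_vec_lambda)
  fix j :: 4
  show "((\<lambda>x. if j = 1 then fst (f x) else if j = 2 then snd (f x) else if j = 3 then fst (g x) else snd (g x))
    has_derivative (\<lambda>w. if j = 1 then fst (f' w) else if j = 2 then snd (f' w) else if j = 3 then fst (g' w) else snd (g' w))) F"
    using has_derivative_fst[OF assms(1)] has_derivative_snd[OF assms(1)]
      has_derivative_fst[OF assms(2)] has_derivative_snd[OF assms(2)]
    by (cases "j = 1"; cases "j = 2"; cases "j = 3") simp_all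
qed

lemma cnj2_has_derivative: "(cnj2 has_derivative cnj2) F"
  unfolding cnj2_def[abs_def]
  by (intro bounded_linear_imp_has_derivative bounded_linear_Pair bounded_linear_fst bounded_linear_snd
      bounded_linear_compose[OF bounded_linear_cnj])

text \<open>Joint continuity provides one radius around \<mu> = 1 that serves all \<open>u\<close>
  near \<open>p\<close>.\<close>

lemma isCont_ray: "isCont (\<lambda>x. ray (fst x) (snd x)) (p, 1)"
proof -
  have c: "isCont (\<lambda>x. snd x * fst (fst x)) (p, 1::complex)" "isCont (\<lambda>x. snd x * snd (fst x)) (p, 1)"
    "isCont (\<lambda>x. cnj (fst (fst x)) / snd x) (p, 1::complex)" "isCont (\<lambda>x. cnj (snd (fst x)) / snd x) (p, 1)"
    by (auto intro!: isCont_mult isCont_divide isCont_cnj isCont_fst isCont_snd)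
  show ?thesis
    unfolding isCont_def ray_def lift4_def cscale_def cnj2_def
  proof (rule tendsto_vec_lambda, goal_cases)
    case (1 j)
    show ?case
      using c[unfolded isCont_def] by (cases "j = 1"; cases "j = 2"; cases "j = 3") simp_all
  qed
qed

section \<open>Continuation from an arc of the unit circle\<close>

lemma islimpt_unit_circle:
  assumes "\<delta> > 0"
  shows "(1::complex) islimpt {\<mu>. norm \<mu> = 1} \<inter> ball 1 \<delta>"
proof -
  have limpt: "(1::complex) islimpt sphere 0 1"
  proof (rule connected_imp_perfect)
    show "connected (sphere (0::complex) 1)" by (rule connected_sphere) simp
    show "sphere (0::complex) 1 \<noteq> {a}" for a
    proof
      assume a: "sphere (0::complex) 1 = {a}"
      have "(1::complex) \<in> sphere 0 1" "-1 \<in> sphere (0::complex) 1" by auto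
      then show False unfolding a by auto
    qed
  qed auto
  show ?thesis
  proof (rule islimptI)
    fix T :: "complex set" assume "1 \<in> T" "open T"
    then obtain y where "y \<in> sphere 0 1" "y \<in> T \<inter> ball 1 \<delta>" "y \<noteq> 1"
      using islimptE[OF limpt, of "T \<inter> ball 1 \<delta>"] assms by auto
    then show "\<exists>y\<in>{\<mu>. norm \<mu> = 1} \<inter> ball 1 \<delta>. y \<in> T \<and> y \<noteq> 1" by auto
  qed
qed

text \<open>The arc accumulates at the centre 1, so the identity theorem applies.\<close>

lemma holomorphic_unit_circle_zero:
  assumes f: "f holomorphic_on ball 1 \<delta>" and "\<And>\<mu>. \<mu> \<in> ball 1 \<delta> \<Longrightarrow> norm \<mu> = 1 \<Longrightarrow> f \<mu> = 0"
    and "w \<in> ball 1 \<delta>"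
  shows "f w = 0"
proof (rule analytic_continuation[OF f open_ball connected_ball])
  have "0 \<le> dist 1 w" by simp
  then have "\<delta> > 0" using assms(3) unfolding mem_ball by linarith
  then show "1 \<in> ball 1 \<delta>" "(1::complex) islimpt {\<mu>. norm \<mu> = 1} \<inter> ball 1 \<delta>"
    using islimpt_unit_circle by auto
qed (use assms in auto)

text \<open>The continuation of \<open>f\<close> from an arc of the circle through
  \<open>z / |z|\<close> to the parameter \<open>|z|\<close>. It refers to \<open>f\<close> alone,
  so that extensions built at different points of the sphere can be compared.\<close>

definition radial_extension :: "(complex \<times> complex \<Rightarrow> complex) \<Rightarrow> complex \<times> complex \<Rightarrow> complex \<Rightarrow> bool" where
  "radial_extension f z c \<longleftrightarrow> (\<exists>\<delta> \<phi>. \<phi> holomorphic_on ball 1 \<delta> \<and> of_real (norm z) \<in> ball (1::complex) \<delta> \<and>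
     \<phi> (of_real (norm z)) = c \<and>
     (\<forall>\<mu>\<in>ball 1 \<delta>. norm \<mu> = 1 \<longrightarrow> \<phi> \<mu> = f (cscale \<mu> ((1 / norm z) *\<^sub>R z))))"

text \<open>The two discs are concentric; the smaller one contains the point \<open>norm z\<close>
  and an arc on which both continuations equal \<open>f\<close>.\<close>

lemma radial_extension_unique:
  assumes "radial_extension f z c" "radial_extension f z d"
  shows "c = d"
proof -
  let ?r = "of_real (norm z) :: complex" and ?u = "(1 / norm z) *\<^sub>R z"
  obtain \<delta> \<phi> where \<phi>: "\<phi> holomorphic_on ball 1 \<delta>" "?r \<in> ball 1 \<delta>" "\<phi> ?r = c"
    "\<And>\<mu>. \<mu> \<in> ball 1 \<delta> \<Longrightarrow> norm \<mu> = 1 \<Longrightarrow> \<phi> \<mu> = f (cscale \<mu> ?u)"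
    using assms(1) unfolding radial_extension_def by blast
  obtain \<epsilon> \<psi> where \<psi>: "\<psi> holomorphic_on ball 1 \<epsilon>" "?r \<in> ball 1 \<epsilon>" "\<psi> ?r = d"
    "\<And>\<mu>. \<mu> \<in> ball 1 \<epsilon> \<Longrightarrow> norm \<mu> = 1 \<Longrightarrow> \<psi> \<mu> = f (cscale \<mu> ?u)"
    using assms(2) unfolding radial_extension_def by blast
  have sub: "ball (1::complex) (min \<delta> \<epsilon>) \<subseteq> ball 1 \<delta>" "ball (1::complex) (min \<delta> \<epsilon>) \<subseteq> ball 1 \<epsilon>"
    by auto
  have "\<phi> ?r - \<psi> ?r = 0"
  proof (rule holomorphic_unit_circle_zero[of "\<lambda>t. \<phi> t - \<psi> t"])
    show "(\<lambda>t. \<phi> t - \<psi> t) holomorphic_on ball 1 (min \<delta> \<epsilon>)"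
      by (intro holomorphic_on_diff holomorphic_on_subset[OF \<phi>(1)] holomorphic_on_subset[OF \<psi>(1)] sub)
    show "\<phi> \<mu> - \<psi> \<mu> = 0" if "\<mu> \<in> ball 1 (min \<delta> \<epsilon>)" "norm \<mu> = 1" for \<mu>
      using \<phi>(4)[OF _ that(2)] \<psi>(4)[OF _ that(2)] that(1) by simp
    show "?r \<in> ball 1 (min \<delta> \<epsilon>)" using \<phi>(2) \<psi>(2) by simp
  qed
  then show ?thesis using \<phi>(3) \<psi>(3) by simp
qed

lemma radial_extension_S3:
  assumes "z \<in> S3" "radial_extension f z c"
  shows "c = f z"
  using assms by (auto simp: radial_extension_def S3_iff_norm cscale_def)

text \<open>Both derivatives within the sphere agree on \<open>v1 q\<close> and
  \<open>v2 q = J (v1 q)\<close>. In \<open>D (v1 q) + \<i> * D (v2 q)\<close> the complex linear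
  part of \<open>D\<close> cancels and the antilinear part doubles.\<close>

lemma CR_complexified:
  assumes q: "q \<in> S3"
    and F: "(F has_derivative (\<lambda>V. \<Sum>j\<in>UNIV. a j * V $ j)) (at (lift4 q (cnj2 q)))"
    and U: "open U" "q \<in> U" "\<And>z. z \<in> U \<inter> S3 \<Longrightarrow> f z = F (lift4 z (cnj2 z))"
    and f: "(f has_derivative f') (at q within S3)" "f' (v1 q) + \<i> * f' (v2 q) = 0"
  shows "fst q * a 4 = snd q * a 3"
proof -
  let ?D = "\<lambda>w. \<Sum>j\<in>UNIV. a j * lift4 w (cnj2 w) $ j"
  have D: "((\<lambda>z. F (lift4 z (cnj2 z))) has_derivative ?D) (at q within S3)"
    by (rule has_derivative_compose[OF lift4_has_derivative[OF has_derivative_ident cnj2_has_derivative] F])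
  obtain d where d: "d > 0" "ball q d \<subseteq> U" using U open_contains_ball by blast
  have "(f has_derivative ?D) (at q within S3)"
  proof (rule has_derivative_transform_within[OF D d(1) q])
    show "F (lift4 z (cnj2 z)) = f z" if "z \<in> S3" "dist z q < d" for z
      using U(3)[of z] subsetD[OF d(2), of z] that by (simp add: dist_commute)
  qed
  then have "f' w = ?D w" if "w \<in> tangent_S3 q" for w
    using has_derivative_S3_unique[OF q that f(1)] by blast
  moreover have "v1 q \<in> tangent_S3 q" "v2 q \<in> tangent_S3 q"
    using hopf_frame_inner[OF q] by (auto simp: tangent_S3_def)
  ultimately have "?D (v1 q) + \<i> * ?D (v2 q) = 0" using f(2) by simp
  moreover have "?D (v1 q) + \<i> * ?D (v2 q) = 2 * (fst q * a 4 - snd q * a 3)"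
    unfolding sum_4 v2_eq v1_eq J_def cnj2_def by (simp add: algebra_simps)
  ultimately show ?thesis by simp
qed

text \<open>By the CR equation the derivative of \<open>F\<close> in \<open>w\<close> is a multiple \<open>\<kappa>\<close> of \<open>z\<close>, and the antilinear parts of
  \<open>\<kappa> z \<bullet> d(cnj z / |z|^2)\<close> cancel.\<close>

lemma holomorphic_of_complexified_CR:
  assumes z: "z \<noteq> 0"
    and F: "(F has_derivative (\<lambda>V. \<Sum>j\<in>UNIV. a j * V $ j)) (at (lift4 z (inverse (z \<bullet> z) *\<^sub>R cnj2 z)))"
    and CR: "fst z * a 4 = snd z * a 3"
  shows "\<exists>c d. ((\<lambda>z. F (lift4 z (inverse (z \<bullet> z) *\<^sub>R cnj2 z))) has_derivative (\<lambda>w. c * fst w + d * snd w)) (at z)"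
proof -
  define s where "s = z \<bullet> z"
  have s: "s \<noteq> 0" using z by (simp add: s_def)
  have s_eq: "of_real s = fst z * cnj (fst z) + snd z * cnj (snd z)"
    by (simp add: s_def inner_pair_complex complex_eq_iff)
  have re: "of_real (2 * (z \<bullet> w)) = fst z * cnj (fst w) + snd z * cnj (snd w)
      + cnj (fst z) * fst w + cnj (snd z) * snd w" for w
    by (simp add: inner_pair_complex complex_eq_iff)
  have "z \<bullet> z \<noteq> 0" using z by simp
  note inv = Deriv.has_derivative_inverse[OF this has_derivative_inner[OF has_derivative_ident has_derivative_ident]]
  note N = has_derivative_scaleR[OF inv cnj2_has_derivative, folded s_def]
  have eq: "inverse s *\<^sub>R cnj2 w + (- (inverse s * (z \<bullet> w + w \<bullet> z) * inverse s)) *\<^sub>R cnj2 z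
      = (1 / s) *\<^sub>R cnj2 w - (2 * (z \<bullet> w) / s\<^sup>2) *\<^sub>R cnj2 z" for w
  proof -
    have "- (inverse s * (z \<bullet> w + w \<bullet> z) * inverse s) = - (2 * (z \<bullet> w) / s\<^sup>2)"
      unfolding inner_commute[of w z] using s by (simp add: field_simps power2_eq_square)
    then show ?thesis by (simp only: inverse_eq_divide scaleR_minus_left diff_conv_add_uminus)
  qed
  note D = has_derivative_compose[OF lift4_has_derivative[OF has_derivative_ident N[unfolded eq]] F]
  define \<kappa> where "\<kappa> = (a 3 * cnj (fst z) + a 4 * cnj (snd z)) / of_real s"
  have \<kappa>: "a 3 = \<kappa> * fst z" "a 4 = \<kappa> * snd z"
  proof -
    have "a 3 * of_real s = (a 3 * cnj (fst z) + a 4 * cnj (snd z)) * fst z"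
      "a 4 * of_real s = (a 3 * cnj (fst z) + a 4 * cnj (snd z)) * snd z"
      using CR unfolding s_eq by algebra+
    then show "a 3 = \<kappa> * fst z" "a 4 = \<kappa> * snd z"
      using s by (simp_all add: \<kappa>_def eq_divide_eq)
  qed
  have "(\<Sum>j\<in>UNIV. a j * lift4 w ((1 / s) *\<^sub>R cnj2 w - (2 * (z \<bullet> w) / s\<^sup>2) *\<^sub>R cnj2 z) $ j)
      = (a 1 - \<kappa> * cnj (fst z) / of_real s) * fst w + (a 2 - \<kappa> * cnj (snd z) / of_real s) * snd w" for w
  proof -
    have "(\<Sum>j\<in>UNIV. a j * lift4 w ((1 / s) *\<^sub>R cnj2 w - (2 * (z \<bullet> w) / s\<^sup>2) *\<^sub>R cnj2 z) $ j)
        = a 1 * fst w + a 2 * snd w + \<kappa> * (fst z * cnj (fst w) + snd z * cnj (snd w)) / of_real s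
          - of_real (2 * (z \<bullet> w)) * \<kappa> * (fst z * cnj (fst z) + snd z * cnj (snd z)) / (of_real s)\<^sup>2"
      unfolding sum_4 \<kappa> cnj2_def using s by (simp add: scaleR_conv_of_real field_simps)
    also have "\<dots> = a 1 * fst w + a 2 * snd w + \<kappa> * (fst z * cnj (fst w) + snd z * cnj (snd w)) / of_real s
          - of_real (2 * (z \<bullet> w)) * \<kappa> / of_real s"
      unfolding s_eq[symmetric] using s by (simp add: power2_eq_square)
    also have "\<dots> = (a 1 - \<kappa> * cnj (fst z) / of_real s) * fst w + (a 2 - \<kappa> * cnj (snd z) / of_real s) * snd w"
      unfolding re using s by (simp add: field_simps)
    finally show ?thesis .
  qed
  with D show ?thesis by auto
qed

section \<open>Extension of CR functions\<close>

lemma eventually_in_open_of_isCont: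
  assumes "isCont f x" "open S" "f x \<in> S"
  shows "\<forall>\<^sub>F y in nhds x. f y \<in> S"
  using topological_tendstoD[of f "f x" "nhds x" S] assms
  unfolding isCont_def tendsto_at_iff_tendsto_nhds by blast

text \<open>The conclusion gives \<open>radial_extension\<close> and not just agreement on the
  sphere: it determines \<open>h\<close> on all of \<open>W\<close>, which makes the local pieces
  fit together.\<close>

lemma CR_local_extension:
  assumes p: "p \<in> S3" and an: "real_analytic_at g p" and U: "open U" "p \<in> U"
    and g: "\<And>q. q \<in> U \<inter> S3 \<Longrightarrow> f q = cnj (fst q * snd (g q) - snd q * fst (g q))"
    and CR: "\<And>q. q \<in> S3 \<Longrightarrow> \<exists>f'. (f has_derivative f') (at q within S3) \<and> f' (v1 q) + \<i> * f' (v2 q) = 0"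
  obtains W h where "open W" "p \<in> W" "\<And>z. z \<in> W \<Longrightarrow> radial_extension f z (h z)"
    "\<And>z. z \<in> W \<Longrightarrow> \<exists>c d. (h has_derivative (\<lambda>w. c * fst w + d * snd w)) (at z)"
proof -
  obtain \<phi> R K where poly: "\<And>n. cpoly (\<phi> n)" and R: "R > 0" and K: "summable K"
    and bound: "\<And>n Z. Z \<in> ball (lift4 p (cnj2 p)) R \<Longrightarrow> norm (\<phi> n Z) \<le> K n"
    and sums: "\<And>z. lift4 z (cnj2 z) \<in> ball (lift4 p (cnj2 p)) R \<Longrightarrow>
      (\<lambda>n. \<phi> n (lift4 z (cnj2 z))) sums cnj (fst z * snd (g z) - snd z * fst (g z))"
    by (rule real_analytic_at_complexify[OF an]) blast
  define F where "F = (\<lambda>Z. \<Sum>n. \<phi> n Z)"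
  define B where "B = ball (lift4 p (cnj2 p)) (R / 2)"
  obtain A where A: "\<forall>Z\<in>B. (F has_derivative (\<lambda>V. \<Sum>j\<in>UNIV. A j Z * V $ j)) (at Z)"
    and holo: "\<forall>S \<gamma>. open S \<longrightarrow> (\<forall>j. (\<lambda>t. \<gamma> t $ j) holomorphic_on S) \<longrightarrow> \<gamma> ` S \<subseteq> B \<longrightarrow>
      (\<lambda>t. F (\<gamma> t)) holomorphic_on S \<and> (\<forall>j. (\<lambda>t. A j (\<gamma> t)) holomorphic_on S)"
    unfolding B_def F_def 
    by (rule cpoly_series[of \<phi> R "lift4 p (cnj2 p)" K, OF poly R _ K], rule bound, assumption,
        rule that[unfolded B_def F_def])
  note A = bspec[OF A] and holo = holo[rule_format]
  define U' where "U' = {z \<in> U. lift4 z (cnj2 z) \<in> B}"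
  have "continuous_on UNIV (\<lambda>z. lift4 z (cnj2 z))"
    by (intro continuous_at_imp_continuous_on ballI
        has_derivative_continuous[OF lift4_has_derivative[OF has_derivative_ident cnj2_has_derivative]])
  then have "open ((\<lambda>z. lift4 z (cnj2 z)) -` B)"
    unfolding B_def by (intro open_vimage) auto
  moreover have "U' = U \<inter> (\<lambda>z. lift4 z (cnj2 z)) -` B" by (auto simp: U'_def)
  ultimately have "open U'" using U(1) by (simp add: open_Int)
  have F_eq: "f z = F (lift4 z (cnj2 z))" if "z \<in> U' \<inter> S3" for z
  proof -
    have "lift4 z (cnj2 z) \<in> ball (lift4 p (cnj2 p)) R" using that R by (auto simp: U'_def B_def)
    from sums_unique[OF sums[OF this]] show ?thesis
      using g[of z] that by (simp add: F_def U'_def)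
  qed
  have CR_A: "fst q * A 4 (lift4 q (cnj2 q)) = snd q * A 3 (lift4 q (cnj2 q))" if q: "q \<in> U' \<inter> S3" for q
  proof -
    obtain f' where "(f has_derivative f') (at q within S3)" "f' (v1 q) + \<i> * f' (v2 q) = 0"
      using CR q by blast
    with q show ?thesis
      by (intro CR_complexified[of q F _ U' f f'] A \<open>open U'\<close> F_eq) (auto simp: U'_def)
  qed
  have ray_p: "ray p 1 = lift4 p (cnj2 p)" using ray_unit[of 1 p] by (simp add: cscale_def)
  \<comment> \<open>Near \<open>(p, 1)\<close> the ray stays where \<open>F\<close> is
    differentiable, and by the second condition its unit circle points lie over \<open>U\<close>,
    where \<open>F\<close> represents \<open>f\<close>.\<close>
  have "\<forall>\<^sub>F x in nhds (p, 1). ray (fst x) (snd x) \<in> B"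
    by (rule eventually_in_open_of_isCont[OF isCont_ray]) (use R ray_p in \<open>simp_all add: B_def\<close>)
  moreover have "isCont (\<lambda>x. cscale (snd x) (fst x)) (p, 1)"
    unfolding cscale_def by (intro continuous_intros)
  then have "\<forall>\<^sub>F x in nhds (p, 1). cscale (snd x) (fst x) \<in> U"
    by (rule eventually_in_open_of_isCont) (use U in \<open>simp_all add: cscale_def\<close>)
  ultimately have "\<forall>\<^sub>F x in nhds (p, 1). ray (fst x) (snd x) \<in> B \<and> cscale (snd x) (fst x) \<in> U"
    by (rule eventually_conj)
  then obtain \<epsilon> where \<epsilon>: "\<epsilon> > 0"
    "\<And>x. dist x (p, 1) < \<epsilon> \<Longrightarrow> ray (fst x) (snd x) \<in> B \<and> cscale (snd x) (fst x) \<in> U"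
    unfolding eventually_nhds_metric by blast
  \<comment> \<open>The bound 1 keeps the pole \<mu> = 0 of the ray out of the disc; the half is for
    the sum of the distances in \<open>u\<close> and \<mu>.\<close>
  define \<delta> where "\<delta> = min 1 (\<epsilon> / 2)"
  have \<delta>: "\<delta> > 0" "\<delta> \<le> 1" "2 * \<delta> \<le> \<epsilon>" using \<epsilon>(1) by (auto simp: \<delta>_def)
  have near: "ray u \<mu> \<in> B" "cscale \<mu> u \<in> U" if "u \<in> ball p \<delta>" "\<mu> \<in> ball 1 \<delta>" for u \<mu>
  proof -
    have "dist (u, \<mu>) (p, 1) \<le> dist u p + dist \<mu> 1"
      unfolding dist_Pair_Pair using sqrt_sum_squares_le_sum[of "dist u p" "dist \<mu> 1"] by simp
    also have "\<dots> < \<epsilon>" using that \<delta> by (simp add: dist_commute)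
    finally show "ray u \<mu> \<in> B" "cscale \<mu> u \<in> U" using \<epsilon>(2)[of "(u, \<mu>)"] by auto
  qed
  have B0: "(0::complex) \<notin> ball 1 \<delta>" using \<delta> by simp
  define h where "h z = F (lift4 z (inverse (z \<bullet> z) *\<^sub>R cnj2 z))" for z
  define N where "N z = (1 / norm z) *\<^sub>R z" for z :: "complex \<times> complex"
  define W where "W = {z \<in> - {0}. N z \<in> ball p \<delta> \<and> of_real (norm z) \<in> ball (1::complex) \<delta>}"
  \<comment> \<open>With \<open>u = z / |z|\<close> and \<mu> = \<open>|z|\<close> the last two
    coordinates become \<open>cnj z / |z|^2\<close>, so \<open>h z\<close> is the value of
    \<open>F\<close> on the ray at the parameter \<open>|z|\<close>.\<close>
  have ray_N: "ray (N z) (of_real (norm z)) = lift4 z (inverse (z \<bullet> z) *\<^sub>R cnj2 z)" if "z \<noteq> 0" for z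
    using that unfolding ray_def N_def cscale_def cnj2_def
    by (simp add: dot_square_norm power2_eq_square scaleR_conv_of_real divide_inverse mult_ac)
  have N_S3: "N z \<in> S3" if "z \<noteq> 0" for z using that by (simp add: N_def S3_iff_norm)
  have unit: "cscale \<mu> (N z) \<in> U' \<inter> S3" "ray (N z) \<mu> = lift4 (cscale \<mu> (N z)) (cnj2 (cscale \<mu> (N z)))"
    if "z \<in> W" "\<mu> \<in> ball 1 \<delta>" "norm \<mu> = 1" for z \<mu>
    using that near[of "N z" \<mu>] cscale_S3[OF that(3) N_S3[of z]] ray_unit[OF that(3), of "N z"]
    by (auto simp: W_def U'_def)
  have ray_B: "ray (N z) ` ball 1 \<delta> \<subseteq> B" if "z \<in> W" for z
    using that near(1)[of "N z"] unfolding W_def by blast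
  have ray_holo: "(\<lambda>t. ray u t $ j) holomorphic_on ball 1 \<delta>" for u j
    by (rule holomorphic_on_ray[OF B0])
  show thesis
  proof (rule that)
    have "continuous_on (- {0}) N" "continuous_on (- {0}) (\<lambda>z :: complex \<times> complex. complex_of_real (norm z))"
      unfolding N_def by (intro continuous_intros; simp)+
    then have "open ((- {0} \<inter> N -` ball p \<delta>) \<inter> (- {0} \<inter> (\<lambda>z. complex_of_real (norm z)) -` ball 1 \<delta>))"
      by (intro open_Int continuous_open_preimage) auto
    also have "\<dots> = W" by (auto simp: W_def)
    finally show "open W" .
    show "p \<in> W" using p \<delta> by (auto simp: W_def N_def S3_iff_norm)
    show "radial_extension f z (h z)" if z: "z \<in> W" for z
      unfolding radial_extension_def N_def[symmetric]
    proof (intro exI conjI ballI impI)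
      show "(\<lambda>t. F (ray (N z) t)) holomorphic_on ball 1 \<delta>"
        using holo[OF open_ball ray_holo ray_B[OF z]] by blast
      show "of_real (norm z) \<in> ball (1::complex) \<delta>" using z by (simp add: W_def)
      show "F (ray (N z) (of_real (norm z))) = h z"
        using ray_N z by (simp add: W_def h_def)
      show "F (ray (N z) \<mu>) = f (cscale \<mu> (N z))" if "\<mu> \<in> ball 1 \<delta>" "norm \<mu> = 1" for \<mu>
        using F_eq unit[OF z that] by simp
    qed
    show "\<exists>c d. (h has_derivative (\<lambda>w. c * fst w + d * snd w)) (at z)" if z: "z \<in> W" for z
    proof -
      \<comment> \<open>The defect of the complexified CR equation along the ray. It vanishes for
        \<open>norm \<mu> = 1\<close> by \<open>CR_A\<close>, hence also at \<mu> =
        \<open>norm z\<close>.\<close>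
      define L where "L t = fst (cscale t (N z)) * A 4 (ray (N z) t) - snd (cscale t (N z)) * A 3 (ray (N z) t)" for t
      have z': "z \<noteq> 0" "of_real (norm z) \<in> ball (1::complex) \<delta>" using z by (auto simp: W_def)
      have "L (of_real (norm z)) = 0"
      proof (rule holomorphic_unit_circle_zero[OF _ _ z'(2)])
        show "L holomorphic_on ball 1 \<delta>"
          unfolding L_def cscale_def fst_conv snd_conv
          by (intro holomorphic_intros holo[OF open_ball ray_holo ray_B[OF z], THEN conjunct2, rule_format])
        show "L \<mu> = 0" if "\<mu> \<in> ball 1 \<delta>" "norm \<mu> = 1" for \<mu>
          using CR_A[OF unit(1)[OF z that]] unit(2)[OF z that] by (simp add: L_def)
      qed
      moreover have "cscale (of_real (norm z)) (N z) = z"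
        using z' by (simp add: cscale_def N_def scaleR_conv_of_real prod_eq_iff)
      ultimately have CRz: "fst z * A 4 (lift4 z (inverse (z \<bullet> z) *\<^sub>R cnj2 z))
          = snd z * A 3 (lift4 z (inverse (z \<bullet> z) *\<^sub>R cnj2 z))"
        using ray_N[OF z'(1)] by (simp add: L_def)
      have "lift4 z (inverse (z \<bullet> z) *\<^sub>R cnj2 z) \<in> B"
        using subsetD[OF ray_B[OF z] imageI[OF z'(2)]] unfolding ray_N[OF z'(1)] .
      from holomorphic_of_complexified_CR[OF z'(1) A[OF this] CRz]
      show ?thesis unfolding h_def[abs_def] .
    qed
  qed
qed

text \<open>By uniqueness of radial extensions the definite description \<open>h\<close> coincides
  with the chosen local extension on each \<open>W p\<close>, from which it inherits complex
  differentiability.\<close>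

lemma CR_extension:
  assumes an: "real_analytic_on_submanifold E S3"
    and f: "\<And>q. q \<in> S3 \<Longrightarrow> f q = cnj (fst q * snd (E q) - snd q * fst (E q))"
    and CR: "\<And>q. q \<in> S3 \<Longrightarrow> \<exists>f'. (f has_derivative f') (at q within S3) \<and> f' (v1 q) + \<i> * f' (v2 q) = 0"
  shows "\<exists>h U. S3 \<subseteq> U \<and> holomorphic2_on h U \<and> (\<forall>q\<in>S3. h q = f q)"
proof -
  define P where "P p W h \<longleftrightarrow> open W \<and> p \<in> W \<and> (\<forall>z\<in>W. radial_extension f z (h z)) \<and>
      (\<forall>z\<in>W. \<exists>c d. (h has_derivative (\<lambda>w. c * fst w + d * snd w)) (at z))" for p W and h :: "complex \<times> complex \<Rightarrow> complex"
  have "\<forall>p\<in>S3. \<exists>Wh. P p (fst Wh) (snd Wh)"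
  proof
    fix p assume p: "p \<in> S3"
    from an p have "\<exists>U g. open U \<and> p \<in> U \<and> (\<forall>q\<in>U. real_analytic_at g q) \<and> (\<forall>q\<in>U \<inter> S3. g q = E q)"
      unfolding real_analytic_on_submanifold_def by (rule bspec)
    then obtain U g where U: "open U" "p \<in> U" "\<forall>q\<in>U. real_analytic_at g q" "\<forall>q\<in>U \<inter> S3. g q = E q"
      by (elim exE conjE)
    have g: "f q = cnj (fst q * snd (g q) - snd q * fst (g q))" if "q \<in> U \<inter> S3" for q
      using f[of q] U(4) that by simp
    show "\<exists>Wh. P p (fst Wh) (snd Wh)"
    proof (rule CR_local_extension[of p g U f])
      show "real_analytic_at g p" using U(2,3) by (rule bspec[rotated])
      fix W h
      assume "open W" "p \<in> W" "\<And>z. z \<in> W \<Longrightarrow> radial_extension f z (h z)"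
        "\<And>z. z \<in> W \<Longrightarrow> \<exists>c d. (h has_derivative (\<lambda>w. c * fst w + d * snd w)) (at z)"
      then have "P p W h" unfolding P_def by (intro conjI ballI)
      then show "\<exists>Wh. P p (fst Wh) (snd Wh)" by (intro exI[of _ "(W, h)"]) simp
    qed (fact p U g CR)+
  qed
  from bchoice[OF this] obtain Wk where "\<forall>p\<in>S3. P p (fst (Wk p)) (snd (Wk p))" by (rule exE)
  moreover define W k where "W p = fst (Wk p)" and "k p = snd (Wk p)" for p
  ultimately have P: "P p (W p) (k p)" if "p \<in> S3" for p using that by simp
  have W: "open (W p)" "p \<in> W p" if "p \<in> S3" for p using P[OF that] by (simp_all add: P_def)
  have k: "radial_extension f z (k p z)"
      "\<exists>c d. (k p has_derivative (\<lambda>w. c * fst w + d * snd w)) (at z)" if "p \<in> S3" "z \<in> W p" for p z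
    using P[OF that(1)] that(2) by (simp_all add: P_def)
  define h where "h z = (THE c. radial_extension f z c)" for z
  have h: "h z = k p z" if "p \<in> S3" "z \<in> W p" for p z
    unfolding h_def using k(1)[OF that] by (rule the_equality) (rule radial_extension_unique[OF _ k(1)[OF that]])
  show ?thesis
  proof (intro exI conjI ballI)
    show "S3 \<subseteq> (\<Union>p\<in>S3. W p)" using W by blast
    show "h q = f q" if "q \<in> S3" for q
      using h[OF that W(2)[OF that]] radial_extension_S3[OF that k(1)[OF that W(2)[OF that]]] by simp
    have "\<exists>c d. (h has_derivative (\<lambda>w. c * fst w + d * snd w)) (at z)" if pz: "p \<in> S3" "z \<in> W p" for p z
    proof -
      obtain c d where "(k p has_derivative (\<lambda>w. c * fst w + d * snd w)) (at z)" using k(2)[OF pz] by blast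
      then have "(h has_derivative (\<lambda>w. c * fst w + d * snd w)) (at z)"
        by (rule has_derivative_transform_within_open[OF _ W(1)[OF pz(1)] pz(2)]) (simp add: h[OF pz(1)])
      then show ?thesis by blast
    qed
    then show "holomorphic2_on h (\<Union>p\<in>S3. W p)"
      unfolding holomorphic2_on_def using W(1) by (auto intro!: open_UN)
  qed
qed

section \<open>Bateman fields and divergence-free Legendrian pairs\<close>

theorem theorem1p1:
  fixes E0 B0 :: "complex \<times> complex \<Rightarrow> complex \<times> complex"
  assumes "real_analytic_on_submanifold E0 S3"
    and "legendrian E0"
    and "\<forall>p\<in>S3. B0 p = J (E0 p)"
  shows "(\<exists>h F. bateman_hopf_field h F \<and> (\<forall>p\<in>S3. legendrian_pair h p = (E0 p, B0 p)))
           \<longleftrightarrow> divergence_free_S3 E0 \<and> divergence_free_S3 B0"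
proof -
  define f where "f = (\<lambda>q. cnj (fst q * snd (E0 q) - snd q * fst (E0 q)))"
  have E: "E0 q = legendrian_field f q" if "q \<in> S3" for q
    using legendrian_field_of_legendrian[OF assms(2) that] unfolding f_def .
  have B: "B0 q = J (E0 q)" if "q \<in> S3" for q using assms(3) that by blast
  have pair: "legendrian_pair h q = (E0 q, B0 q) \<longleftrightarrow> h q = f q" if "q \<in> S3" for h q
  proof -
    have "legendrian_pair h q = (legendrian_field f q, J (legendrian_field f q)) \<longleftrightarrow> h q = f q"
    proof
      assume "legendrian_pair h q = (legendrian_field f q, J (legendrian_field f q))"
      then have "legendrian_field h q = legendrian_field f q"
        unfolding legendrian_pair_eq by (rule Pair_inject)
      then show "h q = f q" by (rule legendrian_field_inj[OF that])
    next
      assume "h q = f q"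
      then have "legendrian_field h q = legendrian_field f q" by (simp only: legendrian_field_def)
      then show "legendrian_pair h q = (legendrian_field f q, J (legendrian_field f q))"
        by (simp only: legendrian_pair_eq)
    qed
    then show ?thesis by (simp only: B[OF that] E[OF that])
  qed
  show ?thesis
  proof
    assume "\<exists>h F. bateman_hopf_field h F \<and> (\<forall>p\<in>S3. legendrian_pair h p = (E0 p, B0 p))"
    then obtain h U where h: "S3 \<subseteq> U" "holomorphic2_on h U" "\<And>q. q \<in> S3 \<Longrightarrow> h q = f q"
      using pair unfolding bateman_hopf_field_def by blast
    have "has_divergence_S3 E0 0 p \<and> has_divergence_S3 B0 0 p" if p: "p \<in> S3" for p
    proof -
      obtain a b where "(h has_derivative (\<lambda>w. a * fst w + b * snd w)) (at p)"
        using h p unfolding holomorphic2_on_def by blast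
      then have "(h has_derivative (\<lambda>w. a * fst w + b * snd w)) (at p within S3)"
        by (rule has_derivative_at_withinI)
      then have "(f has_derivative (\<lambda>w. a * fst w + b * snd w)) (at p within S3)"
        by (rule has_derivative_transform[OF p h(3)[symmetric], rotated])
      then have "has_divergence_S3 E0 0 p \<and> has_divergence_S3 B0 0 p \<longleftrightarrow>
          a * fst (v1 p) + b * snd (v1 p) + \<i> * (a * fst (v2 p) + b * snd (v2 p)) = 0"
        by (rule divergence_free_pair_iff[OF p]) (erule E B)+
      \<comment> \<open>A complex linear derivative satisfies the CR equation, as
        \<open>v2 p\<close> is \<i> times \<open>v1 p\<close>.\<close>
      then show ?thesis by (simp add: v1_eq v2_eq J_def algebra_simps)
    qed
    then show "divergence_free_S3 E0 \<and> divergence_free_S3 B0"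
      by (simp add: divergence_free_S3_def)
  next
    assume div: "divergence_free_S3 E0 \<and> divergence_free_S3 B0"
    have CR: "\<exists>f'. (f has_derivative f') (at q within S3) \<and> f' (v1 q) + \<i> * f' (v2 q) = 0" if q: "q \<in> S3" for q
    proof -
      \<comment> \<open>Having a divergence includes differentiability within the sphere, which
        passes from \<open>E0\<close> to \<open>f\<close>.\<close>
      obtain D where D: "(E0 has_derivative D) (at q within S3)"
        using div q unfolding divergence_free_S3_def has_divergence_S3_def by blast
      note D1 = has_derivative_mult[OF has_derivative_fst[OF has_derivative_ident] has_derivative_snd[OF D]]
      note D2 = has_derivative_mult[OF has_derivative_snd[OF has_derivative_ident] has_derivative_fst[OF D]]
      have "\<exists>f'. (f has_derivative f') (at q within S3)"
        unfolding f_def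
        by (rule exI, rule bounded_linear.has_derivative[OF bounded_linear_cnj has_derivative_diff[OF D1 D2]])
      then obtain f' where f': "(f has_derivative f') (at q within S3)" by (rule exE)
      have "has_divergence_S3 E0 0 q \<and> has_divergence_S3 B0 0 q \<longleftrightarrow> f' (v1 q) + \<i> * f' (v2 q) = 0"
        by (rule divergence_free_pair_iff[OF q f']) (erule E B)+
      then show ?thesis using f' div q unfolding divergence_free_S3_def by blast
    qed
    have "\<exists>h U. S3 \<subseteq> U \<and> holomorphic2_on h U \<and> (\<forall>q\<in>S3. h q = f q)"
      by (rule CR_extension[OF assms(1)]) (simp only: f_def, rule CR)
    then obtain h U where "S3 \<subseteq> U" "holomorphic2_on h U" "\<forall>q\<in>S3. h q = f q"
      by (elim exE conjE)
    \<comment> \<open>Once \<open>h\<close> is holomorphic near the sphere, the defining formula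
      itself provides the Bateman field.\<close>
    moreover define F where "F x = h (hopf_alpha (fst x) (snd x), hopf_beta (fst x) (snd x)) *s
      ccross (gradient (\<lambda>r. hopf_alpha r (snd x)) (fst x)) (gradient (\<lambda>r. hopf_beta r (snd x)) (fst x))" for x
    ultimately have "bateman_hopf_field h F \<and> (\<forall>p\<in>S3. legendrian_pair h p = (E0 p, B0 p))"
      using pair unfolding bateman_hopf_field_def by auto
    then show "\<exists>h F. bateman_hopf_field h F \<and> (\<forall>p\<in>S3. legendrian_pair h p = (E0 p, B0 p))"
      by blast
  qed
qed

end
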